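(* For all $x,y,x',y'\in M$, $$\langle\langle x,y\rangle\rangle=\langle\langle x',y'\rangle\rangle \iff x=x' \text{ and } y=y'.$$
   Context: Work in ZFA, i.e. ZF with a set $A$ of atoms. Fix a preorder $\preccurlyeq$ on $A$ with no minimal elements: for every $a\in A$ there is $b\in A$ with $b\preccurlyeq a$ and $a\not\preccurlyeq b$. For $a\in A$ let $pr(a)=\{b\in A:b\preccurlyeq a\}$. Define the magmatic hierarchy: $M_1$ is the set of nonempty subsets $x\subseteq A$ that are downward closed ($a\in x$ and $b\preccurlyeq a$ imply $b\in x$); for $\alpha\geq 1$, $M_{\alpha+1}$ is the set of nonempty $x\subseteq M_\alpha$ such that for every $y\in x$, every $z\in M_\alpha$ with $z\subseteq y$ belongs to $x$; $M_\lambda=\bigcup_{1\leq\beta<\lambda}M_\beta$ for limit $\lambda$; $M=\bigcup_{\alpha\geq1}M_\alpha$. For $x\in M$ let $pr(x)=\{y\in M:y\subseteq x\}$, and $pr^2=pr\circ pr$. Fix two atoms $a_0,a_1\in A$ incomparable under $\preccurlyeq$ ($a_0\not\preccurlyeq a_1$ and $a_1\not\preccurlyeq a_0$). For $x,y\in M$ the magmatic pair is $\langle\langle x,y\rangle\rangle:=pr(pr^2(x)\cup pr^2(a_0))\cup pr(pr^2(y)\cup pr^2(a_1))$. *)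

theory Defs
  imports Main
begin

text \<open>
  Set theory with atoms, ZFA, is rendered as the class of all its first-order models: the type is
  the universe of the model. Separation and Replacement range only over first-order formulas with
  parameters, so that no second-order comprehension is assumed of the model. Formulas use
  de Bruijn indices; the constants for the empty set and for the set of atoms may enter a formula
  as parameters and therefore need no syntax of their own.
\<close>

datatype fm = Member nat nat | Equal nat nat | Neg fm | And fm fm | Exists fm

primrec sat :: "('v \<Rightarrow> 'v \<Rightarrow> bool) \<Rightarrow> (nat \<Rightarrow> 'v) \<Rightarrow> fm \<Rightarrow> bool" where
  "sat E e (Member i j) \<longleftrightarrow> E (e i) (e j)"
| "sat E e (Equal i j) \<longleftrightarrow> e i = e j"
| "sat E e (Neg p) \<longleftrightarrow> \<not> sat E e p"
| "sat E e (And p q) \<longleftrightarrow> sat E e p \<and> sat E e q"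
| "sat E e (Exists p) \<longleftrightarrow> (\<exists>x. sat E (case_nat x e) p)"

class zfa =
  fixes mem :: "'a \<Rightarrow> 'a \<Rightarrow> bool"  (infix \<open>\<^bold>\<in>\<close> 50)
    and nul :: 'a
    and atoms :: 'a
  assumes empty_set: "\<not> x \<^bold>\<in> nul"
    and atoms: "z \<^bold>\<in> atoms \<longleftrightarrow> z \<noteq> nul \<and> (\<nexists>x. x \<^bold>\<in> z)"
    and extensionality:
      "\<not> x \<^bold>\<in> atoms \<Longrightarrow> \<not> y \<^bold>\<in> atoms \<Longrightarrow> (\<forall>z. z \<^bold>\<in> x \<longleftrightarrow> z \<^bold>\<in> y) \<Longrightarrow> x = y"
    and foundation: "\<exists>x. x \<^bold>\<in> s \<Longrightarrow> \<exists>x. x \<^bold>\<in> s \<and> \<not> (\<exists>z. z \<^bold>\<in> x \<and> z \<^bold>\<in> s)"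
    and pairing: "\<exists>p. \<forall>z. z \<^bold>\<in> p \<longleftrightarrow> z = x \<or> z = y"
    and union: "\<exists>v. \<forall>z. z \<^bold>\<in> v \<longleftrightarrow> (\<exists>y. z \<^bold>\<in> y \<and> y \<^bold>\<in> u)"
    and powerset:
      "\<exists>v. \<forall>y. y \<^bold>\<in> v \<longleftrightarrow> \<not> y \<^bold>\<in> atoms \<and> (\<forall>z. z \<^bold>\<in> y \<longrightarrow> z \<^bold>\<in> u)"
    and infinity:
      "\<exists>s. nul \<^bold>\<in> s \<and>
         (\<forall>x. x \<^bold>\<in> s \<longrightarrow> (\<exists>y. y \<^bold>\<in> s \<and> (\<forall>z. z \<^bold>\<in> y \<longleftrightarrow> z \<^bold>\<in> x \<or> z = x)))"
    and separation:
      "\<exists>v. \<forall>x. x \<^bold>\<in> v \<longleftrightarrow> x \<^bold>\<in> u \<and> sat (\<^bold>\<in>) (case_nat x e) p"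
    and replacement:
      "(\<And>x y z. x \<^bold>\<in> u \<Longrightarrow> sat (\<^bold>\<in>) (case_nat x (case_nat y e)) p \<Longrightarrow>
          sat (\<^bold>\<in>) (case_nat x (case_nat z e)) p \<Longrightarrow> y = z) \<Longrightarrow>
       \<exists>v. \<forall>y. y \<^bold>\<in> v \<longleftrightarrow> (\<exists>x. x \<^bold>\<in> u \<and> sat (\<^bold>\<in>) (case_nat x (case_nat y e)) p)"

definition is_set :: "'v::zfa \<Rightarrow> bool" where
  "is_set x \<longleftrightarrow> \<not> x \<^bold>\<in> atoms"

definition subset_of :: "'v::zfa \<Rightarrow> 'v \<Rightarrow> bool"  (infix \<open>\<^bold>\<subseteq>\<close> 50) where
  "x \<^bold>\<subseteq> y \<longleftrightarrow> is_set x \<and> is_set y \<and> (\<forall>z. z \<^bold>\<in> x \<longrightarrow> z \<^bold>\<in> y)"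

text \<open>The set of the model whose elements are those satisfying \<open>P\<close>, when there is one.\<close>

definition the_set :: "('v::zfa \<Rightarrow> bool) \<Rightarrow> 'v" where
  "the_set P = (THE v. is_set v \<and> (\<forall>z. z \<^bold>\<in> v \<longleftrightarrow> P z))"

definition upair :: "'v::zfa \<Rightarrow> 'v \<Rightarrow> 'v" where
  "upair x y = the_set (\<lambda>z. z = x \<or> z = y)"

definition kpair :: "'v::zfa \<Rightarrow> 'v \<Rightarrow> 'v" where
  "kpair x y = upair (upair x x) (upair x y)"

definition un :: "'v::zfa \<Rightarrow> 'v \<Rightarrow> 'v"  (infixl \<open>\<^bold>\<union>\<close> 65) where
  "x \<^bold>\<union> y = the_set (\<lambda>z. z \<^bold>\<in> x \<or> z \<^bold>\<in> y)"

definition osucc :: "'v::zfa \<Rightarrow> 'v" where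
  "osucc x = the_set (\<lambda>z. z \<^bold>\<in> x \<or> z = x)"

text \<open>Von Neumann ordinals of the model; the elements of an ordinal are required to be sets
  because an atom is vacuously transitive.\<close>

definition transitive_set :: "'v::zfa \<Rightarrow> bool" where
  "transitive_set x \<longleftrightarrow> is_set x \<and> (\<forall>y z. y \<^bold>\<in> x \<longrightarrow> z \<^bold>\<in> y \<longrightarrow> z \<^bold>\<in> x)"

definition ordinal :: "'v::zfa \<Rightarrow> bool" where
  "ordinal \<alpha> \<longleftrightarrow> transitive_set \<alpha> \<and> (\<forall>\<beta>. \<beta> \<^bold>\<in> \<alpha> \<longrightarrow> transitive_set \<beta>)"

definition limit_ordinal :: "'v::zfa \<Rightarrow> bool" where
  "limit_ordinal \<alpha> \<longleftrightarrow> ordinal \<alpha> \<and> \<alpha> \<noteq> nul \<and> (\<forall>\<beta>. \<beta> \<^bold>\<in> \<alpha> \<longrightarrow> osucc \<beta> \<^bold>\<in> \<alpha>)"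

definition atom_le :: "'v::zfa \<Rightarrow> 'v \<Rightarrow> 'v \<Rightarrow> bool" where
  "atom_le R b a \<longleftrightarrow> kpair b a \<^bold>\<in> R"

definition preorder_on_atoms :: "'v::zfa \<Rightarrow> bool" where
  "preorder_on_atoms R \<longleftrightarrow>
     is_set R \<and>
     (\<forall>p. p \<^bold>\<in> R \<longrightarrow> (\<exists>a b. a \<^bold>\<in> atoms \<and> b \<^bold>\<in> atoms \<and> p = kpair a b)) \<and>
     (\<forall>a. a \<^bold>\<in> atoms \<longrightarrow> atom_le R a a) \<and>
     (\<forall>a b c. atom_le R a b \<longrightarrow> atom_le R b c \<longrightarrow> atom_le R a c)"

definition no_minimal_atoms :: "'v::zfa \<Rightarrow> bool" where
  "no_minimal_atoms R \<longleftrightarrow>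
     (\<forall>a. a \<^bold>\<in> atoms \<longrightarrow> (\<exists>b. b \<^bold>\<in> atoms \<and> atom_le R b a \<and> \<not> atom_le R a b))"

definition magma_base :: "'v::zfa \<Rightarrow> 'v" where
  "magma_base R = the_set (\<lambda>x. x \<^bold>\<subseteq> atoms \<and> x \<noteq> nul \<and>
     (\<forall>a b. a \<^bold>\<in> x \<longrightarrow> b \<^bold>\<in> atoms \<longrightarrow> atom_le R b a \<longrightarrow> b \<^bold>\<in> x))"

definition magma_next :: "'v::zfa \<Rightarrow> 'v" where
  "magma_next m = the_set (\<lambda>x. x \<^bold>\<subseteq> m \<and> x \<noteq> nul \<and>
     (\<forall>y z. y \<^bold>\<in> x \<longrightarrow> z \<^bold>\<in> m \<longrightarrow> z \<^bold>\<subseteq> y \<longrightarrow> z \<^bold>\<in> x))"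

definition app :: "'v::zfa \<Rightarrow> 'v \<Rightarrow> 'v" where
  "app f x = (THE y. kpair x y \<^bold>\<in> f)"

text \<open>\<open>magma_seq R \<alpha> f\<close>: inside the model, \<open>f\<close> is the function with domain the ordinals
  \<open>1 \<le> \<beta> \<le> \<alpha>\<close> that obeys the recursion of the magmatic hierarchy.\<close>

definition magma_seq :: "'v::zfa \<Rightarrow> 'v \<Rightarrow> 'v \<Rightarrow> bool" where
  "magma_seq R \<alpha> f \<longleftrightarrow>
     is_set f \<and>
     (\<forall>p. p \<^bold>\<in> f \<longrightarrow> (\<exists>\<beta> m. \<beta> \<^bold>\<in> osucc \<alpha> \<and> \<beta> \<noteq> nul \<and> p = kpair \<beta> m)) \<and>
     (\<forall>\<beta>. \<beta> \<^bold>\<in> osucc \<alpha> \<and> \<beta> \<noteq> nul \<longrightarrow> (\<exists>!m. kpair \<beta> m \<^bold>\<in> f)) \<and>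
     (osucc nul \<^bold>\<in> osucc \<alpha> \<longrightarrow> app f (osucc nul) = magma_base R) \<and>
     (\<forall>\<beta>. \<beta> \<noteq> nul \<and> osucc \<beta> \<^bold>\<in> osucc \<alpha> \<longrightarrow> app f (osucc \<beta>) = magma_next (app f \<beta>)) \<and>
     (\<forall>\<gamma>. limit_ordinal \<gamma> \<and> \<gamma> \<^bold>\<in> osucc \<alpha> \<longrightarrow>
        app f \<gamma> = the_set (\<lambda>x. \<exists>\<beta>. \<beta> \<^bold>\<in> \<gamma> \<and> \<beta> \<noteq> nul \<and> x \<^bold>\<in> app f \<beta>))"

definition magma_level :: "'v::zfa \<Rightarrow> 'v \<Rightarrow> 'v" where
  "magma_level R \<alpha> = app (THE f. magma_seq R \<alpha> f) \<alpha>"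

text \<open>The hierarchy is a proper class of the model, hence a HOL set.\<close>

definition magmas :: "'v::zfa \<Rightarrow> 'v set" where
  "magmas R = {x. \<exists>\<alpha>. ordinal \<alpha> \<and> \<alpha> \<noteq> nul \<and> x \<^bold>\<in> magma_level R \<alpha>}"

definition pr :: "'v::zfa \<Rightarrow> 'v \<Rightarrow> 'v" where
  "pr R x =
     (if x \<^bold>\<in> atoms then the_set (\<lambda>b. b \<^bold>\<in> atoms \<and> atom_le R b x)
      else the_set (\<lambda>y. y \<in> magmas R \<and> y \<^bold>\<subseteq> x))"

definition magma_pair :: "'v::zfa \<Rightarrow> 'v \<Rightarrow> 'v \<Rightarrow> 'v \<Rightarrow> 'v \<Rightarrow> 'v" where
  "magma_pair R a0 a1 x y =
     pr R (pr R (pr R x) \<^bold>\<union> pr R (pr R a0)) \<^bold>\<union> pr R (pr R (pr R y) \<^bold>\<union> pr R (pr R a1))"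

end

theory Submission
  imports Defs
begin

text \<open>
  Put \<open>U(x,a) = pr(pr(x)) \<union> pr(pr(a))\<close>. Although this union mixes levels, it is a magma: every
  nonempty set of magmas that is closed under magma subsets is one, since the levels of its elements
  are bounded by a limit ordinal \<open>\<gamma>\<close>, which puts it in level \<open>\<gamma> + 1\<close>. Hence \<open>U(x,a)\<close> is an element
  of \<open>pr(U(x,a))\<close>, and equality of two pairs makes \<open>U(x,a0)\<close> a subset of \<open>U(x',a0)\<close> or of
  \<open>U(y',a1)\<close>. The second is impossible, since \<open>pr(a0)\<close> contains the atom \<open>a0\<close>, which is neither a
  magma nor below \<open>a1\<close>. In the first, \<open>pr(x)\<close> contains no atoms and so lies in \<open>pr(pr(x'))\<close>, which
  gives \<open>x \<subseteq> x'\<close>.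

  Separation and Replacement hold only for first-order formulas, so transfinite induction and
  recursion are available only for definable classes; closure properties of definability with
  parameters replace explicit formulas.
\<close>

section \<open>Definability with parameters\<close>

primrec rename :: "(nat \<Rightarrow> nat) \<Rightarrow> fm \<Rightarrow> fm" where
  "rename f (Member i j) = Member (f i) (f j)"
| "rename f (Equal i j) = Equal (f i) (f j)"
| "rename f (Neg p) = Neg (rename f p)"
| "rename f (And p q) = And (rename f p) (rename f q)"
| "rename f (Exists p) = Exists (rename (case_nat 0 (\<lambda>i. Suc (f i))) p)"

lemma sat_rename: "sat E e (rename f p) \<longleftrightarrow> sat E (\<lambda>i. e (f i)) p"
proof (induction p arbitrary: e f)
  case (Exists p)
  have "(\<lambda>i. case_nat x e (case_nat 0 (\<lambda>i. Suc (f i)) i)) = case_nat x (\<lambda>i. e (f i))" for x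
    by (auto simp: fun_eq_iff split: nat.split)
  then show ?case by (simp add: Exists.IH)
qed auto

text \<open>A formula variable denotes an entry of the environment (\<open>Inl\<close>) or a parameter (\<open>Inr\<close>).\<close>

definition assign :: "(nat \<Rightarrow> nat + 'v) \<Rightarrow> (nat \<Rightarrow> 'v) \<Rightarrow> nat \<Rightarrow> 'v" where
  "assign g e i = (case g i of Inl j \<Rightarrow> e j | Inr c \<Rightarrow> c)"

definition definable :: "((nat \<Rightarrow> 'v::zfa) \<Rightarrow> bool) \<Rightarrow> bool" where
  "definable Q \<longleftrightarrow> (\<exists>p g. \<forall>e. Q e \<longleftrightarrow> sat (\<^bold>\<in>) (assign g e) p)"

lemma definableI:
  assumes "\<And>e. Q e \<longleftrightarrow> sat (\<^bold>\<in>) (assign g e) p"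
  shows "definable Q"
  using assms unfolding definable_def by blast

lemma definable_rename:
  assumes "definable Q"
  shows "definable (\<lambda>e. Q (\<lambda>i. e (f i)))"
proof -
  obtain p g where sat_p: "\<And>e. Q e \<longleftrightarrow> sat (\<^bold>\<in>) (assign g e) p"
    using assms unfolding definable_def by blast
  have "assign g (\<lambda>i. e (f i)) = assign (\<lambda>i. map_sum f id (g i)) e" for e
    by (auto simp: assign_def fun_eq_iff split: sum.split)
  then show ?thesis by (intro definableI) (simp add: sat_p)
qed

lemma definable_mem_var: "definable (\<lambda>e. e i \<^bold>\<in> e j)"
  by (rule definableI[of _ Inl "Member i j"]) (simp add: assign_def)

lemma definable_eq_var: "definable (\<lambda>e. e i = e j)"
  by (rule definableI[of _ Inl "Equal i j"]) (simp add: assign_def)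

lemma definable_eq_const: "definable (\<lambda>e. e i = c)"
  by (rule definableI[of _ "case_nat (Inl i) (\<lambda>_. Inr c)" "Equal 0 1"]) (simp add: assign_def)

lemma definable_not:
  assumes "definable P"
  shows "definable (\<lambda>e. \<not> P e)"
  using assms unfolding definable_def by (metis sat.simps(3))

lemma definable_conj:
  assumes "definable P" "definable Q"
  shows "definable (\<lambda>e. P e \<and> Q e)"
proof -
  obtain p g where sat_p: "\<And>e. P e \<longleftrightarrow> sat (\<^bold>\<in>) (assign g e) p"
    using assms(1) unfolding definable_def by blast
  obtain q h where sat_q: "\<And>e. Q e \<longleftrightarrow> sat (\<^bold>\<in>) (assign h e) q"
    using assms(2) unfolding definable_def by blast
  let ?k = "\<lambda>n. if even n then g (n div 2) else h (n div 2)"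
  have "P e \<and> Q e \<longleftrightarrow>
      sat (\<^bold>\<in>) (assign ?k e) (And (rename (\<lambda>i. 2 * i) p) (rename (\<lambda>i. Suc (2 * i)) q))" for e
    by (simp add: sat_p sat_q sat_rename assign_def[abs_def])
  then show ?thesis by (rule definableI)
qed

lemma definable_ex:
  assumes "definable (\<lambda>e. P (e 0) (\<lambda>i. e (Suc i)))"
  shows "definable (\<lambda>e. \<exists>x. P x e)"
proof -
  obtain p g where sat_p: "\<And>e. P (e 0) (\<lambda>i. e (Suc i)) \<longleftrightarrow> sat (\<^bold>\<in>) (assign g e) p"
    using assms unfolding definable_def by blast
  let ?r = "\<lambda>i. if g i = Inl 0 then 0 else Suc i"
    and ?g = "\<lambda>i. map_sum (\<lambda>j. j - Suc 0) id (g i)"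
  have "assign g (case_nat x e) = (\<lambda>i. case_nat x (assign ?g e) (?r i))" for x e
    by (auto simp: assign_def fun_eq_iff split: sum.split nat.split)
  then have "P x e \<longleftrightarrow> sat (\<^bold>\<in>) (case_nat x (assign ?g e)) (rename ?r p)" for x e
    using sat_p[of "case_nat x e"] by (simp add: sat_rename)
  then show ?thesis by (intro definableI[of _ ?g "Exists (rename ?r p)"]) simp
qed

lemma definable_imp:
  assumes "definable P" "definable Q"
  shows "definable (\<lambda>e. P e \<longrightarrow> Q e)"
  using definable_not[OF definable_conj[OF assms(1) definable_not[OF assms(2)]]] by simp

lemma definable_disj:
  assumes "definable P" "definable Q"
  shows "definable (\<lambda>e. P e \<or> Q e)"
  using definable_imp[OF definable_not[OF assms(1)] assms(2)] by (simp add: disj_imp)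

lemma definable_iff:
  assumes "definable P" "definable Q"
  shows "definable (\<lambda>e. P e \<longleftrightarrow> Q e)"
  using definable_conj[OF definable_imp[OF assms] definable_imp[OF assms(2,1)]]
  by (simp add: iff_conv_conj_imp)

lemma definable_all:
  assumes "definable (\<lambda>e. P (e 0) (\<lambda>i. e (Suc i)))"
  shows "definable (\<lambda>e. \<forall>x. P x e)"
  using definable_not[OF definable_ex[of "\<lambda>x e. \<not> P x e", OF definable_not[OF assms]]] by simp

definition definable_term :: "((nat \<Rightarrow> 'v::zfa) \<Rightarrow> 'v) \<Rightarrow> bool" where
  "definable_term F \<longleftrightarrow> definable (\<lambda>e. e 0 = F (\<lambda>i. e (Suc i)))"

lemma definable_term_var: "definable_term (\<lambda>e. e i)"
  unfolding definable_term_def by (rule definable_eq_var)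

lemma definable_term_const: "definable_term (\<lambda>e. c)"
  unfolding definable_term_def by (rule definable_eq_const)

lemma definable_term_rename:
  assumes "definable_term F"
  shows "definable_term (\<lambda>e. F (\<lambda>i. e (f i)))"
  using definable_rename[OF assms[unfolded definable_term_def], of "case_nat 0 (\<lambda>i. Suc (f i))"]
  unfolding definable_term_def by simp

lemma definable_subst:
  assumes "definable_term F" "definable (\<lambda>e. P (e 0) (\<lambda>i. e (Suc i)))"
  shows "definable (\<lambda>e. P (F e) e)"
proof -
  have "definable (\<lambda>e. \<exists>x. x = F e \<and> P x e)"
    using assms unfolding definable_term_def by (intro definable_ex definable_conj)
  then show ?thesis by simp
qed

lemma definable_comp3:
  assumes P: "definable (\<lambda>e. P (e 0) (e 1) (e 2))"
    and F: "definable_term F" and G: "definable_term G" and H: "definable_term H"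
  shows "definable (\<lambda>e. P (F e) (G e) (H e))"
proof -
  have "definable (\<lambda>e. P (F (\<lambda>i. e (Suc (Suc i)))) (e 0) (e 1))"
    using P definable_subst[OF definable_term_rename[OF F], of "\<lambda>x e. P x (e 0) (e 1)"]
    by (simp add: numeral_2_eq_2)
  then have "definable (\<lambda>e. P (F (\<lambda>i. e (Suc i))) (G (\<lambda>i. e (Suc i))) (e 0))"
    using definable_subst[OF definable_term_rename[OF G],
        of "\<lambda>y e. P (F (\<lambda>i. e (Suc i))) y (e 0)"] by simp
  then show ?thesis using definable_subst[OF H, of "\<lambda>z e. P (F e) (G e) z"] by simp
qed

lemma definable_comp2:
  assumes "definable (\<lambda>e. P (e 0) (e 1))" "definable_term F" "definable_term G"
  shows "definable (\<lambda>e. P (F e) (G e))"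
  using definable_comp3[where P = "\<lambda>x y z. P x y" and H = F] assms by simp

lemma definable_comp1:
  assumes "definable (\<lambda>e. P (e 0))" "definable_term F"
  shows "definable (\<lambda>e. P (F e))"
  using definable_comp2[where P = "\<lambda>x y. P x" and G = F] assms by simp

lemma definable_term_comp1:
  assumes "definable_term (\<lambda>e. H (e 0))" "definable_term F"
  shows "definable_term (\<lambda>e. H (F e))"
  using definable_comp2[of "\<lambda>x y. x = H y", OF _ definable_term_var
      definable_term_rename[OF assms(2)]] assms(1)
  unfolding definable_term_def by simp

lemma definable_mem:
  assumes "definable_term F" "definable_term G"
  shows "definable (\<lambda>e. F e \<^bold>\<in> G e)"
  using definable_comp2[of "(\<^bold>\<in>)", OF definable_mem_var assms] .

lemma definable_eq:
  assumes "definable_term F" "definable_term G"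
  shows "definable (\<lambda>e. F e = G e)"
  using definable_comp2[of "(=)", OF definable_eq_var assms] .

named_theorems definable_intros

lemmas [definable_intros] = definable_term_var definable_term_const definable_mem definable_eq
  definable_not definable_conj definable_disj definable_imp definable_iff definable_ex definable_all

lemma definable_is_set [definable_intros]: "definable_term F \<Longrightarrow> definable (\<lambda>e. is_set (F e))"
  unfolding is_set_def by (intro definable_intros)

lemma definable_subset [definable_intros]:
  "definable_term F \<Longrightarrow> definable_term G \<Longrightarrow> definable (\<lambda>e. F e \<^bold>\<subseteq> G e)"
  by (rule definable_comp2[of "(\<^bold>\<subseteq>)"]) (unfold subset_of_def, intro definable_intros)

section \<open>Sets and small classes\<close>

lemma not_mem_nul [simp]: "\<not> x \<^bold>\<in> nul"
  by (rule empty_set)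

lemma is_set_nul [simp]: "is_set nul"
  unfolding is_set_def using atoms by blast

lemma is_setI: "z \<^bold>\<in> x \<Longrightarrow> is_set x"
  unfolding is_set_def using atoms by blast

lemma set_ext:
  assumes "is_set x" "is_set y" "\<And>z. z \<^bold>\<in> x \<longleftrightarrow> z \<^bold>\<in> y"
  shows "x = y"
  using extensionality assms unfolding is_set_def by blast

lemma subset_refl: "is_set x \<Longrightarrow> x \<^bold>\<subseteq> x"
  unfolding subset_of_def by blast

lemma subset_trans: "x \<^bold>\<subseteq> y \<Longrightarrow> y \<^bold>\<subseteq> z \<Longrightarrow> x \<^bold>\<subseteq> z"
  unfolding subset_of_def by blast

lemma subset_antisym: "x \<^bold>\<subseteq> y \<Longrightarrow> y \<^bold>\<subseteq> x \<Longrightarrow> x = y"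
  unfolding subset_of_def by (blast intro: set_ext)

lemma subsetD: "x \<^bold>\<subseteq> y \<Longrightarrow> z \<^bold>\<in> x \<Longrightarrow> z \<^bold>\<in> y"
  unfolding subset_of_def by blast

definition small :: "('v::zfa \<Rightarrow> bool) \<Rightarrow> bool" where
  "small P \<longleftrightarrow> (\<exists>v. \<forall>z. z \<^bold>\<in> v \<longleftrightarrow> P z)"

lemma the_set_equality:
  assumes "is_set v" "\<And>z. z \<^bold>\<in> v \<longleftrightarrow> P z"
  shows "the_set P = v"
  unfolding the_set_def
proof (rule the_equality)
  show "w = v" if "is_set w \<and> (\<forall>z. z \<^bold>\<in> w \<longleftrightarrow> P z)" for w
    using that assms by (intro set_ext) simp_all
qed (use assms in blast)

lemma smallE:
  assumes "small P"
  obtains v where "is_set v" "\<And>z. z \<^bold>\<in> v \<longleftrightarrow> P z"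
proof -
  obtain v where v: "\<And>z. z \<^bold>\<in> v \<longleftrightarrow> P z" using assms unfolding small_def by blast
  show thesis
  proof (cases "is_set v")
    case True
    then show thesis using that v by blast
  next
    case False
    then have "\<not> P z" for z using v is_setI by blast
    then show thesis using that[of nul] by simp
  qed
qed

lemma
  assumes "small P"
  shows is_set_the_set: "is_set (the_set P)"
    and mem_the_set: "z \<^bold>\<in> the_set P \<longleftrightarrow> P z"
proof -
  obtain w where "is_set w" "\<And>z. z \<^bold>\<in> w \<longleftrightarrow> P z" using assms by (rule smallE) blast
  moreover from this have "the_set P = w" by (rule the_set_equality)
  ultimately show "is_set (the_set P)" "z \<^bold>\<in> the_set P \<longleftrightarrow> P z" by simp_all
qed

lemma the_set_not_small:
  assumes "\<not> small P"
  shows "the_set P = (THE v. False)"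
proof -
  have "(is_set v \<and> (\<forall>z. z \<^bold>\<in> v \<longleftrightarrow> P z)) = False" for v
    using assms unfolding small_def by blast
  then show ?thesis unfolding the_set_def by (simp only:)
qed

lemma eq_the_set_iff:
  "v = the_set P \<longleftrightarrow> is_set v \<and> (\<forall>z. z \<^bold>\<in> v \<longleftrightarrow> P z) \<or> \<not> small P \<and> v = (THE v. False)"
proof (cases "small P")
  case True
  then show ?thesis using is_set_the_set mem_the_set the_set_equality by blast
next
  case False
  then show ?thesis using the_set_not_small unfolding small_def by metis
qed

text \<open>No existence assumption is needed: the junk value of \<open>the_set\<close> is a single parameter.\<close>

lemma definable_term_the_set [definable_intros]:
  assumes "definable (\<lambda>e. P (e 0) (\<lambda>i. e (Suc i)))"
  shows "definable_term (\<lambda>e. the_set (\<lambda>z. P z e))"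
proof -
  have "definable (\<lambda>e. P (e 0) (\<lambda>i. e (Suc (Suc i))))"
    "definable (\<lambda>e. P (e 0) (\<lambda>i. e (Suc (Suc (Suc i)))))"
    using definable_rename[OF assms, of "case_nat 0 (\<lambda>i. Suc (Suc i))"]
      definable_rename[OF assms, of "case_nat 0 (\<lambda>i. Suc (Suc (Suc i)))"] by simp_all
  then show ?thesis
    unfolding definable_term_def eq_the_set_iff small_def by (intro definable_intros)
qed

lemma small_separation:
  assumes "definable (\<lambda>e. P (e 0))"
  shows "small (\<lambda>x. x \<^bold>\<in> u \<and> P x)"
proof -
  obtain p g where sat_p: "\<And>e. P (e 0) \<longleftrightarrow> sat (\<^bold>\<in>) (assign g e) p"
    using assms unfolding definable_def by blast
  let ?c = "\<lambda>i. projr (g i)" and ?r = "\<lambda>i. case g i of Inl _ \<Rightarrow> 0 | Inr _ \<Rightarrow> Suc i"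
  have "assign g (\<lambda>_. x) = (\<lambda>i. case_nat x ?c (?r i))" for x
    by (auto simp: assign_def fun_eq_iff split: sum.split)
  then have "P x \<longleftrightarrow> sat (\<^bold>\<in>) (case_nat x ?c) (rename ?r p)" for x
    using sat_p[of "\<lambda>_. x"] by (simp add: sat_rename)
  then show ?thesis unfolding small_def using separation[of u ?c "rename ?r p"] by simp
qed

lemma small_replacement:
  assumes "definable (\<lambda>e. P (e 0) (e 1))"
    and "\<And>x y z. x \<^bold>\<in> u \<Longrightarrow> P x y \<Longrightarrow> P x z \<Longrightarrow> y = z"
  shows "small (\<lambda>y. \<exists>x. x \<^bold>\<in> u \<and> P x y)"
proof -
  obtain p g where sat_p: "\<And>e. P (e 0) (e 1) \<longleftrightarrow> sat (\<^bold>\<in>) (assign g e) p"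
    using assms(1) unfolding definable_def by blast
  let ?c = "\<lambda>i. projr (g i)"
    and ?r = "\<lambda>i. case g i of Inl j \<Rightarrow> min j 1 | Inr _ \<Rightarrow> Suc (Suc i)"
  have "assign g (case_nat x (\<lambda>_. y)) = (\<lambda>i. case_nat x (case_nat y ?c) (?r i))" for x y
    by (auto simp: assign_def fun_eq_iff split: sum.split nat.split)
  then have P: "P x y \<longleftrightarrow> sat (\<^bold>\<in>) (case_nat x (case_nat y ?c)) (rename ?r p)" for x y
    using sat_p[of "case_nat x (\<lambda>_. y)"] by (simp add: sat_rename)
  show ?thesis
    using replacement[of u ?c "rename ?r p"] assms(2) unfolding small_def P by blast
qed

lemma small_subsets:
  assumes "definable (\<lambda>e. P (e 0))"
  shows "small (\<lambda>x. x \<^bold>\<subseteq> m \<and> P x)"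
proof -
  obtain u where u: "\<forall>y. y \<^bold>\<in> u \<longleftrightarrow> \<not> y \<^bold>\<in> atoms \<and> (\<forall>z. z \<^bold>\<in> y \<longrightarrow> z \<^bold>\<in> m)"
    using powerset by blast
  have "small (\<lambda>x. x \<^bold>\<in> u \<and> x \<^bold>\<subseteq> m \<and> P x)"
    using assms by (intro small_separation definable_intros)
  moreover have "x \<^bold>\<in> u" if "x \<^bold>\<subseteq> m" for x
    using u that unfolding subset_of_def is_set_def by blast
  ultimately show ?thesis unfolding small_def by metis
qed

lemma small_Union: "small (\<lambda>z. \<exists>y. y \<^bold>\<in> u \<and> z \<^bold>\<in> y)"
  using union[of u] unfolding small_def by (simp add: conj_commute)

lemma small_upair: "small (\<lambda>z. z = x \<or> z = y)"
  unfolding small_def by (rule pairing)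

lemma mem_upair [simp]: "z \<^bold>\<in> upair x y \<longleftrightarrow> z = x \<or> z = y"
  unfolding upair_def by (rule mem_the_set[OF small_upair])

lemma is_set_upair [simp]: "is_set (upair x y)"
  unfolding upair_def by (rule is_set_the_set[OF small_upair])

lemma upair_eq_iff: "upair x y = upair u v \<longleftrightarrow> x = u \<and> y = v \<or> x = v \<and> y = u"
proof
  assume "upair x y = upair u v"
  then have "z = x \<or> z = y \<longleftrightarrow> z = u \<or> z = v" for z using mem_upair by metis
  then show "x = u \<and> y = v \<or> x = v \<and> y = u" by metis
qed (auto intro: set_ext)

lemma kpair_eq_iff [simp]: "kpair x y = kpair u v \<longleftrightarrow> x = u \<and> y = v"
  unfolding kpair_def by (auto simp: upair_eq_iff)

lemma small_un: "small (\<lambda>z. z \<^bold>\<in> x \<or> z \<^bold>\<in> y)"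
  using small_Union[of "upair x y"] by (simp add: ex_disj_distrib conj_disj_distribR)

lemma mem_un [simp]: "z \<^bold>\<in> x \<^bold>\<union> y \<longleftrightarrow> z \<^bold>\<in> x \<or> z \<^bold>\<in> y"
  unfolding un_def by (rule mem_the_set[OF small_un])

lemma is_set_un [simp]: "is_set (x \<^bold>\<union> y)"
  unfolding un_def by (rule is_set_the_set[OF small_un])

lemma small_osucc: "small (\<lambda>z. z \<^bold>\<in> x \<or> z = x)"
  using small_un[of x "upair x x"] by simp

lemma mem_osucc [simp]: "z \<^bold>\<in> osucc x \<longleftrightarrow> z \<^bold>\<in> x \<or> z = x"
  unfolding osucc_def by (rule mem_the_set[OF small_osucc])

lemma is_set_osucc [simp]: "is_set (osucc x)"
  unfolding osucc_def by (rule is_set_the_set[OF small_osucc])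

lemma ex_inductive_set: "\<exists>s. nul \<^bold>\<in> s \<and> (\<forall>x. x \<^bold>\<in> s \<longrightarrow> osucc x \<^bold>\<in> s)"
proof -
  obtain s :: 'a where s: "nul \<^bold>\<in> s"
    "\<And>x. x \<^bold>\<in> s \<Longrightarrow> \<exists>y. y \<^bold>\<in> s \<and> (\<forall>z. z \<^bold>\<in> y \<longleftrightarrow> z \<^bold>\<in> x \<or> z = x)"
    using infinity by blast
  have "osucc x \<^bold>\<in> s" if x: "x \<^bold>\<in> s" for x
  proof -
    obtain y where y: "y \<^bold>\<in> s" "\<And>z. z \<^bold>\<in> y \<longleftrightarrow> z \<^bold>\<in> x \<or> z = x" using s(2)[OF x] by blast
    then have "y = osucc x" using is_setI[of x y] by (intro set_ext) simp_all
    then show ?thesis using y(1) by simp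
  qed
  then show ?thesis using s(1) by blast
qed

lemma osucc_neq_nul [simp]: "osucc x \<noteq> nul" "nul \<noteq> osucc x"
  using mem_osucc[of x x] not_mem_nul[of x] by metis+

lemma definable_term_upair [definable_intros]:
  assumes "definable_term F" "definable_term G"
  shows "definable_term (\<lambda>e. upair (F e) (G e))"
proof -
  have "definable_term (\<lambda>e. F (\<lambda>i. e (Suc i)))" "definable_term (\<lambda>e. G (\<lambda>i. e (Suc i)))"
    by (rule assms[THEN definable_term_rename])+
  then show ?thesis unfolding upair_def by (intro definable_intros)
qed

lemma definable_term_kpair [definable_intros]:
  "definable_term F \<Longrightarrow> definable_term G \<Longrightarrow> definable_term (\<lambda>e. kpair (F e) (G e))"
  unfolding kpair_def by (intro definable_intros)

lemma definable_term_osucc [definable_intros]: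
  "definable_term F \<Longrightarrow> definable_term (\<lambda>e. osucc (F e))"
  by (rule definable_term_comp1[of osucc]) (unfold osucc_def, intro definable_intros)

lemma definable_transitive_set [definable_intros]:
  "definable_term F \<Longrightarrow> definable (\<lambda>e. transitive_set (F e))"
  by (rule definable_comp1[of transitive_set]) (unfold transitive_set_def, intro definable_intros)

lemma definable_ordinal [definable_intros]:
  "definable_term F \<Longrightarrow> definable (\<lambda>e. ordinal (F e))"
  by (rule definable_comp1[of ordinal]) (unfold ordinal_def, intro definable_intros)

lemma definable_limit_ordinal [definable_intros]:
  "definable_term F \<Longrightarrow> definable (\<lambda>e. limit_ordinal (F e))"
  by (rule definable_comp1[of limit_ordinal]) (unfold limit_ordinal_def, intro definable_intros)

section \<open>Ordinals\<close>

lemma mem_irrefl [simp]: "\<not> x \<^bold>\<in> x"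
  using foundation[of "upair x x"] by auto

lemma mem_asym: "x \<^bold>\<in> y \<Longrightarrow> \<not> y \<^bold>\<in> x"
  using foundation[of "upair x y"] by auto

lemma osucc_inject [simp]: "osucc x = osucc y \<longleftrightarrow> x = y"
proof
  assume "osucc x = osucc y"
  then have "x \<^bold>\<in> osucc y" "y \<^bold>\<in> osucc x" using mem_osucc by metis+
  then show "x = y" using mem_asym[of x y] by simp blast
qed simp

lemma ordinal_is_set: "ordinal \<alpha> \<Longrightarrow> is_set \<alpha>"
  unfolding ordinal_def transitive_set_def by blast

lemma ordinal_mem: "ordinal \<alpha> \<Longrightarrow> \<beta> \<^bold>\<in> \<alpha> \<Longrightarrow> ordinal \<beta>"
  unfolding ordinal_def transitive_set_def by blast

lemma ordinal_trans: "ordinal \<alpha> \<Longrightarrow> \<beta> \<^bold>\<in> \<alpha> \<Longrightarrow> \<gamma> \<^bold>\<in> \<beta> \<Longrightarrow> \<gamma> \<^bold>\<in> \<alpha>"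
  unfolding ordinal_def transitive_set_def by blast

lemma ordinal_nul [simp]: "ordinal nul"
  unfolding ordinal_def transitive_set_def by simp

lemma ordinal_osucc [simp]:
  assumes "ordinal \<alpha>"
  shows "ordinal (osucc \<alpha>)"
proof -
  have "transitive_set (osucc \<alpha>)"
    using assms unfolding ordinal_def transitive_set_def mem_osucc by (metis is_set_osucc)
  then show ?thesis using assms unfolding ordinal_def mem_osucc by metis
qed

lemma limit_ordinalD:
  assumes "limit_ordinal \<gamma>"
  shows "ordinal \<gamma>" "\<gamma> \<noteq> nul" "\<beta> \<^bold>\<in> \<gamma> \<Longrightarrow> osucc \<beta> \<^bold>\<in> \<gamma>"
  using assms unfolding limit_ordinal_def by blast+

lemma not_limit_ordinal_nul [simp]: "\<not> limit_ordinal nul"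
  unfolding limit_ordinal_def by simp

lemma not_limit_ordinal_osucc [simp]: "\<not> limit_ordinal (osucc \<beta>)"
  using limit_ordinalD(3)[of "osucc \<beta>" \<beta>] by auto

lemma ordinal_least:
  assumes "ordinal \<alpha>" "P \<alpha>" and P: "definable (\<lambda>e. P (e 0))"
  obtains \<beta> where "ordinal \<beta>" "P \<beta>" "\<And>\<gamma>. \<gamma> \<^bold>\<in> \<beta> \<Longrightarrow> \<not> P \<gamma>"
proof -
  obtain v where v: "\<And>x. x \<^bold>\<in> v \<longleftrightarrow> x \<^bold>\<in> osucc \<alpha> \<and> P x"
    using small_separation[OF P, of "osucc \<alpha>"] unfolding small_def by blast
  then have "\<alpha> \<^bold>\<in> v" using \<open>P \<alpha>\<close> by simp
  then obtain \<beta> where \<beta>: "\<beta> \<^bold>\<in> v" "\<And>\<gamma>. \<gamma> \<^bold>\<in> \<beta> \<Longrightarrow> \<not> \<gamma> \<^bold>\<in> v" using foundation[of v] by blast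
  have ord: "ordinal (osucc \<alpha>)" using assms(1) by simp
  have "\<beta> \<^bold>\<in> osucc \<alpha>" "P \<beta>" using \<beta>(1) v by auto
  moreover have "\<not> P \<gamma>" if "\<gamma> \<^bold>\<in> \<beta>" for \<gamma>
    using \<beta>(2) v ordinal_trans[OF ord \<open>\<beta> \<^bold>\<in> osucc \<alpha>\<close> that] that by blast
  ultimately show thesis using that ordinal_mem[OF ord] by blast
qed

lemma ordinal_induct:
  assumes "ordinal \<alpha>" and P: "definable (\<lambda>e. P (e 0))"
    and step: "\<And>\<alpha>. ordinal \<alpha> \<Longrightarrow> (\<And>\<beta>. \<beta> \<^bold>\<in> \<alpha> \<Longrightarrow> P \<beta>) \<Longrightarrow> P \<alpha>"
  shows "P \<alpha>"
proof (rule ccontr)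
  assume "\<not> P \<alpha>"
  then obtain \<beta> where "ordinal \<beta>" "\<not> P \<beta>" "\<And>\<gamma>. \<gamma> \<^bold>\<in> \<beta> \<Longrightarrow> \<not> \<not> P \<gamma>"
    using ordinal_least[OF assms(1), of "\<lambda>\<beta>. \<not> P \<beta>", OF _ definable_not[OF P]] by blast
  then show False using step by blast
qed

lemma ordinal_linear:
  assumes "ordinal \<alpha>" "ordinal \<beta>"
  shows "\<alpha> \<^bold>\<in> \<beta> \<or> \<alpha> = \<beta> \<or> \<beta> \<^bold>\<in> \<alpha>"
proof -
  let ?P = "\<lambda>\<alpha> \<beta>. \<alpha> \<^bold>\<in> \<beta> \<or> \<alpha> = \<beta> \<or> \<beta> \<^bold>\<in> \<alpha>"
  have "\<forall>\<beta>. ordinal \<beta> \<longrightarrow> ?P \<alpha> \<beta>"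
    using assms(1)
  proof (rule ordinal_induct)
    show "definable (\<lambda>e. \<forall>\<beta>. ordinal \<beta> \<longrightarrow> ?P (e 0) \<beta>)" by (intro definable_intros)
    fix \<alpha> :: 'a assume \<alpha>: "ordinal \<alpha>"
      and IH_\<alpha>: "\<And>\<gamma>. \<gamma> \<^bold>\<in> \<alpha> \<Longrightarrow> \<forall>\<beta>. ordinal \<beta> \<longrightarrow> ?P \<gamma> \<beta>"
    have "?P \<alpha> \<beta>" if "ordinal \<beta>" for \<beta>
      using that
    proof (rule ordinal_induct)
      show "definable (\<lambda>e. ?P \<alpha> (e 0))" by (intro definable_intros)
      fix \<beta> assume \<beta>: "ordinal \<beta>" and IH_\<beta>: "\<And>\<gamma>. \<gamma> \<^bold>\<in> \<beta> \<Longrightarrow> ?P \<alpha> \<gamma>"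
      have "\<alpha> = \<beta>" if "\<not> \<alpha> \<^bold>\<in> \<beta>" "\<not> \<beta> \<^bold>\<in> \<alpha>"
      proof (rule set_ext)
        show "is_set \<alpha>" "is_set \<beta>" using \<alpha> \<beta> by (auto intro: ordinal_is_set)
        show "\<gamma> \<^bold>\<in> \<alpha> \<longleftrightarrow> \<gamma> \<^bold>\<in> \<beta>" for \<gamma>
          using IH_\<alpha>[of \<gamma>] IH_\<beta>[of \<gamma>] that \<beta> ordinal_trans[OF \<alpha>, of \<gamma> \<beta>] ordinal_trans[OF \<beta>, of \<gamma> \<alpha>]
          by blast
      qed
      then show "?P \<alpha> \<beta>" by blast
    qed
    then show "\<forall>\<beta>. ordinal \<beta> \<longrightarrow> ?P \<alpha> \<beta>" by blast
  qed
  then show ?thesis using assms(2) by blast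
qed

lemma osucc_mem_osucc:
  assumes "ordinal \<beta>" "\<alpha> \<^bold>\<in> \<beta>"
  shows "osucc \<alpha> \<^bold>\<in> osucc \<beta>"
proof -
  have "\<not> \<beta> \<^bold>\<in> osucc \<alpha>" using assms mem_asym by auto
  then show ?thesis using ordinal_linear[of "osucc \<alpha>" \<beta>] assms ordinal_mem[OF assms] by auto
qed

lemma ordinal_cases [consumes 1, case_names nul osucc limit]:
  assumes "ordinal \<alpha>"
  obtains "\<alpha> = nul" | \<beta> where "\<alpha> = osucc \<beta>" "ordinal \<beta>" | "limit_ordinal \<alpha>"
proof (cases "\<alpha> = nul \<or> limit_ordinal \<alpha>")
  case False
  then obtain \<beta> where \<beta>: "\<beta> \<^bold>\<in> \<alpha>" "\<not> osucc \<beta> \<^bold>\<in> \<alpha>"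
    using assms unfolding limit_ordinal_def by blast
  then have "\<alpha> = osucc \<beta>" using osucc_mem_osucc[OF assms] by auto
  then show thesis using that(2) ordinal_mem[OF assms \<beta>(1)] by blast
qed (use that in blast)

lemma ordinal_Union:
  assumes "\<And>\<beta>. \<beta> \<^bold>\<in> v \<Longrightarrow> ordinal \<beta>"
  obtains \<gamma> where "ordinal \<gamma>" "\<And>\<alpha>. \<alpha> \<^bold>\<in> \<gamma> \<longleftrightarrow> (\<exists>\<beta>. \<beta> \<^bold>\<in> v \<and> \<alpha> \<^bold>\<in> \<beta>)"
proof -
  obtain \<gamma> where \<gamma>: "is_set \<gamma>" "\<And>\<alpha>. \<alpha> \<^bold>\<in> \<gamma> \<longleftrightarrow> (\<exists>\<beta>. \<beta> \<^bold>\<in> v \<and> \<alpha> \<^bold>\<in> \<beta>)"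
    by (rule smallE[OF small_Union[of v]]) blast
  have "transitive_set \<gamma>"
    unfolding transitive_set_def \<gamma>(2) using \<gamma>(1) assms ordinal_trans by blast
  moreover have "transitive_set \<beta>" if "\<beta> \<^bold>\<in> \<gamma>" for \<beta>
    using that assms unfolding \<gamma>(2) ordinal_def by blast
  ultimately have "ordinal \<gamma>" unfolding ordinal_def by blast
  then show thesis using that \<gamma>(2) by blast
qed

section \<open>Recursion on ordinals\<close>

text \<open>\<open>step f \<beta> m\<close>: \<open>m\<close> is the value at \<open>\<beta>\<close>, given the values \<open>f\<close> below \<open>\<beta>\<close>. There may be none,
  so the function defined by the recursion may be partial.\<close>

definition attempt :: "('v::zfa \<Rightarrow> 'v \<Rightarrow> 'v \<Rightarrow> bool) \<Rightarrow> 'v \<Rightarrow> 'v \<Rightarrow> bool" where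
  "attempt step \<alpha> f \<longleftrightarrow> ordinal \<alpha> \<and> is_set f \<and>
     (\<forall>p. p \<^bold>\<in> f \<longleftrightarrow> (\<exists>\<beta> m. \<beta> \<^bold>\<in> \<alpha> \<and> step f \<beta> m \<and> p = kpair \<beta> m))"

definition ordinal_rec :: "('v::zfa \<Rightarrow> 'v \<Rightarrow> 'v \<Rightarrow> bool) \<Rightarrow> 'v \<Rightarrow> 'v \<Rightarrow> bool" where
  "ordinal_rec step \<beta> m \<longleftrightarrow> (\<exists>f. attempt step \<beta> f \<and> step f \<beta> m)"

lemma attempt_ordinal: "attempt step \<alpha> f \<Longrightarrow> ordinal \<alpha>"
  unfolding attempt_def by blast

lemma ordinal_rec_ordinal: "ordinal_rec step \<beta> m \<Longrightarrow> ordinal \<beta>"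
  unfolding ordinal_rec_def attempt_def by blast

lemma kpair_mem_attempt_iff:
  "attempt step \<alpha> f \<Longrightarrow> kpair \<beta> m \<^bold>\<in> f \<longleftrightarrow> \<beta> \<^bold>\<in> \<alpha> \<and> step f \<beta> m"
  unfolding attempt_def by auto

locale ordinal_recursion =
  fixes step :: "'v::zfa \<Rightarrow> 'v \<Rightarrow> 'v \<Rightarrow> bool"
  assumes definable_step: "definable (\<lambda>e. step (e 0) (e 1) (e 2))"
    and step_cong: "\<And>f g \<beta> m. (\<And>\<delta> k. \<delta> \<^bold>\<in> \<beta> \<Longrightarrow> kpair \<delta> k \<^bold>\<in> f \<longleftrightarrow> kpair \<delta> k \<^bold>\<in> g) \<Longrightarrow>
      step f \<beta> m \<longleftrightarrow> step g \<beta> m"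
    and step_functional: "\<And>f \<beta> m m'. step f \<beta> m \<Longrightarrow> step f \<beta> m' \<Longrightarrow>
      (\<And>\<delta> k k'. \<delta> \<^bold>\<in> \<beta> \<Longrightarrow> kpair \<delta> k \<^bold>\<in> f \<Longrightarrow> kpair \<delta> k' \<^bold>\<in> f \<Longrightarrow> k = k') \<Longrightarrow> m = m'"
begin

lemmas definable_step_comp [definable_intros] = definable_comp3[of step, OF definable_step]

lemma definable_attempt [definable_intros]:
  "definable_term F \<Longrightarrow> definable_term G \<Longrightarrow> definable (\<lambda>e. attempt step (F e) (G e))"
  by (rule definable_comp2[of "attempt step"]) (unfold attempt_def, intro definable_intros)

lemma definable_ordinal_rec [definable_intros]:
  "definable_term F \<Longrightarrow> definable_term G \<Longrightarrow> definable (\<lambda>e. ordinal_rec step (F e) (G e))"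
  by (rule definable_comp2[of "ordinal_rec step"]) (unfold ordinal_rec_def, intro definable_intros)

lemma attempts_agree:
  assumes f: "attempt step \<alpha> f" and g: "attempt step \<alpha>' g" and "\<beta> \<^bold>\<in> \<alpha>" "\<beta> \<^bold>\<in> \<alpha>'"
  shows "kpair \<beta> m \<^bold>\<in> f \<longleftrightarrow> kpair \<beta> m \<^bold>\<in> g"
proof -
  note ord = attempt_ordinal[OF f] attempt_ordinal[OF g]
  let ?P = "\<lambda>\<beta>. \<beta> \<^bold>\<in> \<alpha> \<longrightarrow> \<beta> \<^bold>\<in> \<alpha>' \<longrightarrow> (\<forall>m. kpair \<beta> m \<^bold>\<in> f \<longleftrightarrow> kpair \<beta> m \<^bold>\<in> g)"
  have "ordinal \<beta>" using ordinal_mem ord(1) assms(3) by blast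
  then have "?P \<beta>"
  proof (rule ordinal_induct)
    show "definable (\<lambda>e. ?P (e 0))" by (intro definable_intros)
    fix \<beta> assume IH: "\<And>\<delta>. \<delta> \<^bold>\<in> \<beta> \<Longrightarrow> ?P \<delta>"
    show "?P \<beta>"
    proof (intro impI allI)
      fix m assume \<beta>: "\<beta> \<^bold>\<in> \<alpha>" "\<beta> \<^bold>\<in> \<alpha>'"
      have "step f \<beta> m \<longleftrightarrow> step g \<beta> m"
        using IH ordinal_trans[OF ord(1) \<beta>(1)] ordinal_trans[OF ord(2) \<beta>(2)]
        by (intro step_cong) blast
      then show "kpair \<beta> m \<^bold>\<in> f \<longleftrightarrow> kpair \<beta> m \<^bold>\<in> g"
        using \<beta> kpair_mem_attempt_iff f g by blast
    qed
  qed
  then show ?thesis using assms(3,4) by blast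
qed

lemma attempt_unique:
  assumes f: "attempt step \<alpha> f" and g: "attempt step \<alpha> g"
  shows "f = g"
proof (rule set_ext)
  show "is_set f" "is_set g" using f g unfolding attempt_def by blast+
  have "\<exists>\<beta> m. \<beta> \<^bold>\<in> \<alpha> \<and> p = kpair \<beta> m" if "p \<^bold>\<in> f \<or> p \<^bold>\<in> g" for p
    using that f g unfolding attempt_def by blast
  then show "p \<^bold>\<in> f \<longleftrightarrow> p \<^bold>\<in> g" for p using attempts_agree[OF f g] by blast
qed

lemma attempt_functional:
  assumes f: "attempt step \<alpha> f" and m: "kpair \<beta> m \<^bold>\<in> f" "kpair \<beta> m' \<^bold>\<in> f"
  shows "m = m'"
proof -
  have "ordinal \<beta>"
    using f m(1) ordinal_mem attempt_ordinal kpair_mem_attempt_iff by blast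
  then have "\<forall>m m'. kpair \<beta> m \<^bold>\<in> f \<longrightarrow> kpair \<beta> m' \<^bold>\<in> f \<longrightarrow> m = m'"
  proof (rule ordinal_induct)
    show "definable (\<lambda>e. \<forall>m m'. kpair (e 0) m \<^bold>\<in> f \<longrightarrow> kpair (e 0) m' \<^bold>\<in> f \<longrightarrow> m = m')"
      by (intro definable_intros)
  qed (use step_functional kpair_mem_attempt_iff[OF f] in blast)
  then show ?thesis using m by blast
qed

lemma ordinal_rec_iff_step:
  assumes "attempt step \<beta> f"
  shows "ordinal_rec step \<beta> m \<longleftrightarrow> step f \<beta> m"
  unfolding ordinal_rec_def using assms attempt_unique by blast

lemma ordinal_rec_functional:
  assumes "ordinal_rec step \<beta> m" "ordinal_rec step \<beta> m'"
  shows "m = m'"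
proof -
  obtain f where f: "attempt step \<beta> f" "step f \<beta> m"
    using assms(1) unfolding ordinal_rec_def by blast
  then have "step f \<beta> m'" using assms(2) ordinal_rec_iff_step by blast
  then show ?thesis using step_functional f attempt_functional by blast
qed

lemma ex_attempt_below:
  assumes f: "attempt step \<alpha> f" and \<beta>: "\<beta> \<^bold>\<in> \<alpha>"
  shows "\<exists>g. attempt step \<beta> g"
proof -
  have ord: "ordinal \<beta>" using attempt_ordinal[OF f] \<beta> by (rule ordinal_mem)
  have "small (\<lambda>p. p \<^bold>\<in> f \<and> (\<exists>\<delta> k. \<delta> \<^bold>\<in> \<beta> \<and> p = kpair \<delta> k))"
    by (intro small_separation definable_intros)
  then obtain g where g: "is_set g" "\<And>p. p \<^bold>\<in> g \<longleftrightarrow> p \<^bold>\<in> f \<and> (\<exists>\<delta> k. \<delta> \<^bold>\<in> \<beta> \<and> p = kpair \<delta> k)"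
    by (rule smallE) blast
  have "step f \<delta> k \<longleftrightarrow> step g \<delta> k" if "\<delta> \<^bold>\<in> \<beta>" for \<delta> k
    using g(2) ordinal_trans[OF ord that] by (intro step_cong) auto
  then have "attempt step \<beta> g"
    unfolding attempt_def g(2)
    using ord g(1) kpair_mem_attempt_iff[OF f] ordinal_trans[OF attempt_ordinal[OF f] \<beta>] by blast
  then show ?thesis ..
qed

lemma kpair_mem_attempt_iff_rec:
  assumes f: "attempt step \<alpha> f"
  shows "kpair \<beta> m \<^bold>\<in> f \<longleftrightarrow> \<beta> \<^bold>\<in> \<alpha> \<and> ordinal_rec step \<beta> m"
proof (cases "\<beta> \<^bold>\<in> \<alpha>")
  case True
  obtain g where g: "attempt step \<beta> g" using ex_attempt_below[OF f True] by blast
  have "step f \<beta> m \<longleftrightarrow> step g \<beta> m"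
    using attempts_agree[OF f g] ordinal_trans[OF attempt_ordinal[OF f] True]
    by (intro step_cong) blast
  then show ?thesis using kpair_mem_attempt_iff[OF f] ordinal_rec_iff_step[OF g] by blast
next
  case False
  then show ?thesis using kpair_mem_attempt_iff[OF f] by blast
qed

lemma ex_attempt:
  assumes "ordinal \<alpha>"
  shows "\<exists>f. attempt step \<alpha> f"
  using assms
proof (rule ordinal_induct)
  show "definable (\<lambda>e. \<exists>f. attempt step (e 0) f)" by (intro definable_intros)
  fix \<alpha> assume \<alpha>: "ordinal \<alpha>" and IH: "\<And>\<beta>. \<beta> \<^bold>\<in> \<alpha> \<Longrightarrow> \<exists>f. attempt step \<beta> f"
  let ?pair = "\<lambda>\<beta> p. \<exists>m. ordinal_rec step \<beta> m \<and> p = kpair \<beta> m"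
  have "small (\<lambda>p. \<exists>\<beta>. \<beta> \<^bold>\<in> \<alpha> \<and> ?pair \<beta> p)"
  proof (rule small_replacement)
    show "definable (\<lambda>e. ?pair (e 0) (e 1))" by (intro definable_intros)
  qed (use ordinal_rec_functional in blast)
  then obtain f where f: "is_set f" "\<And>p. p \<^bold>\<in> f \<longleftrightarrow> (\<exists>\<beta>. \<beta> \<^bold>\<in> \<alpha> \<and> ?pair \<beta> p)"
    by (rule smallE) blast
  have "ordinal_rec step \<beta> m \<longleftrightarrow> step f \<beta> m" if \<beta>: "\<beta> \<^bold>\<in> \<alpha>" for \<beta> m
  proof -
    obtain g where g: "attempt step \<beta> g" using IH \<beta> by blast
    have "kpair \<delta> k \<^bold>\<in> g \<longleftrightarrow> kpair \<delta> k \<^bold>\<in> f" if "\<delta> \<^bold>\<in> \<beta>" for \<delta> k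
      unfolding kpair_mem_attempt_iff_rec[OF g] f(2) using that ordinal_trans[OF \<alpha> \<beta>] by auto
    then show ?thesis unfolding ordinal_rec_iff_step[OF g] by (rule step_cong)
  qed
  then have "attempt step \<alpha> f" unfolding attempt_def f(2) using \<alpha> f(1) by blast
  then show "\<exists>f. attempt step \<alpha> f" ..
qed

end

section \<open>Limit ordinals\<close>

definition add_step :: "'v::zfa \<Rightarrow> 'v \<Rightarrow> 'v \<Rightarrow> 'v \<Rightarrow> bool" where
  "add_step \<alpha> f n \<beta> \<longleftrightarrow>
     n = nul \<and> \<beta> = \<alpha> \<or> (\<exists>k \<gamma>. n = osucc k \<and> kpair k \<gamma> \<^bold>\<in> f \<and> \<beta> = osucc \<gamma>)"

interpretation add: ordinal_recursion "add_step \<alpha>" for \<alpha> :: "'v::zfa"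
proof
  show "definable (\<lambda>e. add_step \<alpha> (e 0) (e 1) (e 2))"
    unfolding add_step_def by (intro definable_intros)
qed (auto simp: add_step_def, blast)

lemma ordinal_rec_add_nul: "ordinal_rec (add_step \<alpha>) nul \<alpha>"
proof -
  obtain f where f: "attempt (add_step \<alpha>) nul f" using add.ex_attempt ordinal_nul by blast
  show ?thesis unfolding add.ordinal_rec_iff_step[OF f] add_step_def by blast
qed

lemma ordinal_rec_add_osucc:
  assumes "ordinal_rec (add_step \<alpha>) n \<beta>"
  shows "ordinal_rec (add_step \<alpha>) (osucc n) (osucc \<beta>)"
proof -
  have "ordinal (osucc n)" using ordinal_rec_ordinal[OF assms] by simp
  then obtain f where f: "attempt (add_step \<alpha>) (osucc n) f" using add.ex_attempt by blast
  have "kpair n \<beta> \<^bold>\<in> f" unfolding add.kpair_mem_attempt_iff_rec[OF f] using assms by simp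
  then show ?thesis unfolding add.ordinal_rec_iff_step[OF f] add_step_def by blast
qed

lemma limit_ordinal_above:
  fixes \<alpha> :: "'v::zfa"
  assumes "ordinal \<alpha>"
  obtains \<gamma> where "limit_ordinal \<gamma>" "\<alpha> \<^bold>\<in> \<gamma>"
proof -
  obtain s :: 'v where s: "nul \<^bold>\<in> s" "\<And>x. x \<^bold>\<in> s \<Longrightarrow> osucc x \<^bold>\<in> s"
    using ex_inductive_set by blast
  let ?add = "\<lambda>n \<beta>. ordinal \<beta> \<and> ordinal_rec (add_step \<alpha>) n \<beta>"
  have "small (\<lambda>\<beta>. \<exists>n. n \<^bold>\<in> s \<and> ?add n \<beta>)"
  proof (rule small_replacement)
    show "definable (\<lambda>e. ?add (e 0) (e 1))" by (intro definable_intros)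
  qed (use add.ordinal_rec_functional in blast)
  then obtain v where v: "\<And>\<beta>. \<beta> \<^bold>\<in> v \<longleftrightarrow> (\<exists>n. n \<^bold>\<in> s \<and> ?add n \<beta>)" unfolding small_def by blast
  have v_ordinal: "ordinal \<beta>" if "\<beta> \<^bold>\<in> v" for \<beta> using that unfolding v by blast
  have v_osucc: "osucc \<beta> \<^bold>\<in> v" if "\<beta> \<^bold>\<in> v" for \<beta>
    using that ordinal_rec_add_osucc s(2) ordinal_osucc unfolding v by blast
  obtain \<gamma> where \<gamma>: "ordinal \<gamma>" "\<And>\<beta>. \<beta> \<^bold>\<in> \<gamma> \<longleftrightarrow> (\<exists>\<delta>. \<delta> \<^bold>\<in> v \<and> \<beta> \<^bold>\<in> \<delta>)"
    using ordinal_Union[of v] v_ordinal by blast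
  have "\<alpha> \<^bold>\<in> v" unfolding v using s(1) assms ordinal_rec_add_nul by blast
  then have "\<alpha> \<^bold>\<in> \<gamma>" unfolding \<gamma>(2) using v_osucc[of \<alpha>] mem_osucc[of \<alpha> \<alpha>] by blast
  moreover have "osucc \<beta> \<^bold>\<in> \<gamma>" if "\<beta> \<^bold>\<in> \<gamma>" for \<beta>
    using that v_osucc v_ordinal osucc_mem_osucc unfolding \<gamma>(2) by blast
  ultimately show thesis using that \<gamma>(1) not_mem_nul unfolding limit_ordinal_def by blast
qed

lemma limit_ordinal_above_set:
  assumes "\<And>\<alpha>. \<alpha> \<^bold>\<in> v \<Longrightarrow> ordinal \<alpha>"
  obtains \<gamma> where "limit_ordinal \<gamma>" "\<And>\<alpha>. \<alpha> \<^bold>\<in> v \<Longrightarrow> \<alpha> \<^bold>\<in> \<gamma>"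
proof -
  obtain \<sigma> where \<sigma>: "ordinal \<sigma>" "\<And>\<alpha>. \<alpha> \<^bold>\<in> \<sigma> \<longleftrightarrow> (\<exists>\<beta>. \<beta> \<^bold>\<in> v \<and> \<alpha> \<^bold>\<in> \<beta>)"
    using ordinal_Union[of v] assms by blast
  obtain \<gamma> where \<gamma>: "limit_ordinal \<gamma>" "\<sigma> \<^bold>\<in> \<gamma>" using limit_ordinal_above \<sigma>(1) by blast
  have "\<alpha> \<^bold>\<in> \<gamma>" if "\<alpha> \<^bold>\<in> v" for \<alpha>
  proof -
    have "\<not> \<sigma> \<^bold>\<in> \<alpha>" using that \<sigma>(2) mem_irrefl by blast
    then have "\<alpha> \<^bold>\<in> osucc \<sigma>" using ordinal_linear[OF \<sigma>(1) assms[OF that]] by auto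
    moreover have "osucc \<sigma> \<^bold>\<in> \<gamma>" using \<gamma> by (rule limit_ordinalD(3))
    ultimately show ?thesis using ordinal_trans limit_ordinalD(1)[OF \<gamma>(1)] by blast
  qed
  then show thesis using that \<gamma>(1) by blast
qed

section \<open>The magmatic hierarchy\<close>

lemma definable_term_magma_next [definable_intros]:
  "definable_term F \<Longrightarrow> definable_term (\<lambda>e. magma_next (F e))"
  by (rule definable_term_comp1[of magma_next]) (unfold magma_next_def, intro definable_intros)

lemma definable_atom_le [definable_intros]:
  "definable_term F \<Longrightarrow> definable_term G \<Longrightarrow> definable (\<lambda>e. atom_le R (F e) (G e))"
  unfolding atom_le_def by (intro definable_intros)

definition magma_step :: "'v::zfa \<Rightarrow> 'v \<Rightarrow> 'v \<Rightarrow> 'v \<Rightarrow> bool" where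
  "magma_step R f \<beta> m \<longleftrightarrow>
     \<beta> = osucc nul \<and> m = magma_base R \<or>
     (\<exists>\<gamma> k. \<gamma> \<noteq> nul \<and> \<beta> = osucc \<gamma> \<and> kpair \<gamma> k \<^bold>\<in> f \<and> m = magma_next k) \<or>
     limit_ordinal \<beta> \<and> m = the_set (\<lambda>x. \<exists>\<delta> k. \<delta> \<^bold>\<in> \<beta> \<and> kpair \<delta> k \<^bold>\<in> f \<and> x \<^bold>\<in> k)"

lemma magma_step_nul: "\<not> magma_step R f nul m"
  by (simp add: magma_step_def)

lemma magma_step_one: "magma_step R f (osucc nul) m \<longleftrightarrow> m = magma_base R"
  by (auto simp: magma_step_def)

lemma magma_step_osucc:
  "\<gamma> \<noteq> nul \<Longrightarrow> magma_step R f (osucc \<gamma>) m \<longleftrightarrow> (\<exists>k. kpair \<gamma> k \<^bold>\<in> f \<and> m = magma_next k)"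
  by (auto simp: magma_step_def)

lemma magma_step_limit:
  assumes "limit_ordinal \<gamma>"
  shows "magma_step R f \<gamma> m \<longleftrightarrow> m = the_set (\<lambda>x. \<exists>\<delta> k. \<delta> \<^bold>\<in> \<gamma> \<and> kpair \<delta> k \<^bold>\<in> f \<and> x \<^bold>\<in> k)"
  using assms by (auto simp: magma_step_def)

interpretation magma: ordinal_recursion "magma_step R" for R :: "'v::zfa"
proof
  show "definable (\<lambda>e. magma_step R (e 0) (e 1) (e 2))"
    unfolding magma_step_def by (intro definable_intros)
next
  fix f g \<beta> m :: 'v
  assume agree: "\<And>\<delta> k. \<delta> \<^bold>\<in> \<beta> \<Longrightarrow> kpair \<delta> k \<^bold>\<in> f \<longleftrightarrow> kpair \<delta> k \<^bold>\<in> g"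
  have "(\<exists>\<gamma> k. \<gamma> \<noteq> nul \<and> \<beta> = osucc \<gamma> \<and> kpair \<gamma> k \<^bold>\<in> f \<and> m = magma_next k)
      \<longleftrightarrow> (\<exists>\<gamma> k. \<gamma> \<noteq> nul \<and> \<beta> = osucc \<gamma> \<and> kpair \<gamma> k \<^bold>\<in> g \<and> m = magma_next k)"
    using agree by auto
  moreover have "(\<lambda>x. \<exists>\<delta> k. \<delta> \<^bold>\<in> \<beta> \<and> kpair \<delta> k \<^bold>\<in> f \<and> x \<^bold>\<in> k)
      = (\<lambda>x. \<exists>\<delta> k. \<delta> \<^bold>\<in> \<beta> \<and> kpair \<delta> k \<^bold>\<in> g \<and> x \<^bold>\<in> k)"
    using agree by (simp cong: conj_cong)
  ultimately show "magma_step R f \<beta> m \<longleftrightarrow> magma_step R g \<beta> m"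
    unfolding magma_step_def by (simp only:)
next
  fix f \<beta> m m' :: 'v
  assume "magma_step R f \<beta> m" "magma_step R f \<beta> m'"
    and "\<And>\<delta> k k'. \<delta> \<^bold>\<in> \<beta> \<Longrightarrow> kpair \<delta> k \<^bold>\<in> f \<Longrightarrow> kpair \<delta> k' \<^bold>\<in> f \<Longrightarrow> k = k'"
  then show "m = m'" unfolding magma_step_def by (auto, blast)
qed

definition graph_below :: "'v::zfa \<Rightarrow> ('v \<Rightarrow> 'v) \<Rightarrow> 'v \<Rightarrow> bool" where
  "graph_below f F \<beta> \<longleftrightarrow> (\<forall>\<delta> k. \<delta> \<^bold>\<in> \<beta> \<longrightarrow> (kpair \<delta> k \<^bold>\<in> f \<longleftrightarrow> \<delta> \<noteq> nul \<and> k = F \<delta>))"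

lemma kpair_mem_graph_below_iff:
  "graph_below f F \<beta> \<Longrightarrow> \<delta> \<^bold>\<in> \<beta> \<Longrightarrow> kpair \<delta> k \<^bold>\<in> f \<longleftrightarrow> \<delta> \<noteq> nul \<and> k = F \<delta>"
  unfolding graph_below_def by blast

lemma graph_below_mono:
  "ordinal \<alpha> \<Longrightarrow> \<beta> \<^bold>\<in> \<alpha> \<Longrightarrow> graph_below f F \<alpha> \<Longrightarrow> graph_below f F \<beta>"
  unfolding graph_below_def using ordinal_trans by blast

lemma magma_step_osucc_graph:
  assumes "graph_below f F (osucc \<gamma>)" "\<gamma> \<noteq> nul"
  shows "magma_step R f (osucc \<gamma>) m \<longleftrightarrow> m = magma_next (F \<gamma>)"
  using assms by (simp add: magma_step_osucc kpair_mem_graph_below_iff)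

lemma magma_step_limit_graph:
  assumes "graph_below f F \<gamma>" "limit_ordinal \<gamma>"
  shows "magma_step R f \<gamma> m \<longleftrightarrow> m = the_set (\<lambda>x. \<exists>\<delta>. \<delta> \<^bold>\<in> \<gamma> \<and> \<delta> \<noteq> nul \<and> x \<^bold>\<in> F \<delta>)"
proof -
  have "(\<exists>\<delta> k. \<delta> \<^bold>\<in> \<gamma> \<and> kpair \<delta> k \<^bold>\<in> f \<and> x \<^bold>\<in> k) \<longleftrightarrow> (\<exists>\<delta>. \<delta> \<^bold>\<in> \<gamma> \<and> \<delta> \<noteq> nul \<and> x \<^bold>\<in> F \<delta>)" for x
    using kpair_mem_graph_below_iff[OF assms(1)] by metis
  then show ?thesis using assms(2) by (simp add: magma_step_limit)
qed

lemma ordinal_rec_magma_neq_nul: "ordinal_rec (magma_step R) \<alpha> m \<Longrightarrow> \<alpha> \<noteq> nul"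
  unfolding ordinal_rec_def using magma_step_nul by blast

lemma ordinal_rec_magma_ex1:
  assumes "ordinal \<alpha>" "\<alpha> \<noteq> nul"
  shows "\<exists>!m. ordinal_rec (magma_step R) \<alpha> m"
proof -
  let ?P = "\<lambda>\<alpha>. \<alpha> \<noteq> nul \<longrightarrow> (\<exists>m. ordinal_rec (magma_step R) \<alpha> m)"
  have "?P \<alpha>"
    using assms(1)
  proof (rule ordinal_induct)
    show "definable (\<lambda>e. ?P (e 0))" by (intro definable_intros)
    fix \<alpha> assume \<alpha>: "ordinal \<alpha>" and IH: "\<And>\<beta>. \<beta> \<^bold>\<in> \<alpha> \<Longrightarrow> ?P \<beta>"
    obtain f where f: "attempt (magma_step R) \<alpha> f" using magma.ex_attempt \<alpha> by blast
    have "\<exists>m. magma_step R f \<alpha> m" if "\<alpha> \<noteq> nul"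
      using \<alpha>
    proof (cases rule: ordinal_cases)
      case (osucc \<beta>)
      then have "\<beta> = nul \<or> (\<exists>k. kpair \<beta> k \<^bold>\<in> f)"
        using IH unfolding magma.kpair_mem_attempt_iff_rec[OF f] by auto
      then show ?thesis
        unfolding osucc(1) using magma_step_one magma_step_osucc by (cases "\<beta> = nul") blast+
    next
      case limit
      then show ?thesis by (simp add: magma_step_limit)
    qed (use that in blast)
    then show "?P \<alpha>" unfolding magma.ordinal_rec_iff_step[OF f] by blast
  qed
  then show ?thesis using assms(2) magma.ordinal_rec_functional by blast
qed

lemma kpair_mem_iff_app:
  assumes "\<exists>!y. kpair x y \<^bold>\<in> f"
  shows "kpair x y \<^bold>\<in> f \<longleftrightarrow> y = app f x"
  using assms theI'[OF assms] unfolding app_def by blast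

lemma magma_seq_graph:
  assumes "magma_seq R \<alpha> f"
  shows "graph_below f (app f) (osucc \<alpha>)"
  unfolding graph_below_def
proof (intro allI impI)
  fix \<delta> k assume \<delta>: "\<delta> \<^bold>\<in> osucc \<alpha>"
  have "\<delta> \<noteq> nul" if "kpair \<delta> k \<^bold>\<in> f" using assms that unfolding magma_seq_def by fastforce
  moreover have "\<exists>!k. kpair \<delta> k \<^bold>\<in> f" if "\<delta> \<noteq> nul"
    using assms \<delta> that unfolding magma_seq_def by blast
  ultimately show "kpair \<delta> k \<^bold>\<in> f \<longleftrightarrow> \<delta> \<noteq> nul \<and> k = app f \<delta>" using kpair_mem_iff_app by blast
qed

lemma magma_seq_step:
  assumes ord: "ordinal (osucc \<alpha>)" and f: "magma_seq R \<alpha> f" and \<beta>: "\<beta> \<^bold>\<in> osucc \<alpha>"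
  shows "magma_step R f \<beta> m \<longleftrightarrow> \<beta> \<noteq> nul \<and> m = app f \<beta>"
proof -
  have graph: "graph_below f (app f) \<beta>"
    using ord \<beta> magma_seq_graph[OF f] by (rule graph_below_mono)
  from ordinal_mem[OF ord \<beta>] show ?thesis
  proof (cases rule: ordinal_cases)
    case nul
    then show ?thesis using magma_step_nul by blast
  next
    case (osucc \<gamma>)
    show ?thesis
    proof (cases "\<gamma> = nul")
      case True
      moreover have "app f \<beta> = magma_base R"
        using f \<beta> unfolding magma_seq_def osucc(1) True by blast
      ultimately show ?thesis by (simp add: osucc(1) magma_step_one)
    next
      case False
      moreover have "app f \<beta> = magma_next (app f \<gamma>)"
        using f \<beta> False unfolding magma_seq_def osucc(1) by blast
      ultimately show ?thesis using graph osucc(1) magma_step_osucc_graph by simp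
    qed
  next
    case limit
    then have "app f \<beta> = the_set (\<lambda>x. \<exists>\<delta>. \<delta> \<^bold>\<in> \<beta> \<and> \<delta> \<noteq> nul \<and> x \<^bold>\<in> app f \<delta>)"
      using f \<beta> unfolding magma_seq_def by blast
    then show ?thesis
      using magma_step_limit_graph[OF graph limit] limit_ordinalD(2)[OF limit] by simp
  qed
qed

lemma magma_seq_imp_attempt:
  assumes "ordinal \<alpha>" and f: "magma_seq R \<alpha> f"
  shows "attempt (magma_step R) (osucc \<alpha>) f"
proof -
  have ord: "ordinal (osucc \<alpha>)" using assms(1) by simp
  have set: "is_set f" and dom: "\<And>p. p \<^bold>\<in> f \<Longrightarrow> \<exists>\<beta> m. \<beta> \<^bold>\<in> osucc \<alpha> \<and> p = kpair \<beta> m"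
    using f unfolding magma_seq_def by blast+
  have "kpair \<beta> m \<^bold>\<in> f \<longleftrightarrow> magma_step R f \<beta> m" if "\<beta> \<^bold>\<in> osucc \<alpha>" for \<beta> m
    using magma_seq_step[OF ord f that] kpair_mem_graph_below_iff[OF magma_seq_graph[OF f] that]
    by simp
  then show ?thesis unfolding attempt_def using ord set dom by blast
qed

lemma attempt_imp_magma_seq:
  assumes \<alpha>: "ordinal \<alpha>" and f: "attempt (magma_step R) (osucc \<alpha>) f"
  shows "magma_seq R \<alpha> f"
proof -
  have ord: "ordinal (osucc \<alpha>)" using \<alpha> by simp
  have ex1: "\<exists>!m. kpair \<beta> m \<^bold>\<in> f" if "\<beta> \<^bold>\<in> osucc \<alpha>" "\<beta> \<noteq> nul" for \<beta>
    unfolding magma.kpair_mem_attempt_iff_rec[OF f]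
    using that ordinal_rec_magma_ex1[OF ordinal_mem[OF ord]] by blast
  have step: "magma_step R f \<beta> (app f \<beta>)" if "\<beta> \<^bold>\<in> osucc \<alpha>" "\<beta> \<noteq> nul" for \<beta>
    using kpair_mem_iff_app[OF ex1[OF that]] kpair_mem_attempt_iff[OF f] by blast
  have "graph_below f (app f) (osucc \<alpha>)"
    unfolding graph_below_def
    using kpair_mem_iff_app[OF ex1] kpair_mem_attempt_iff[OF f] magma_step_nul by blast
  note graph = graph_below_mono[OF ord _ this]
  show ?thesis
    unfolding magma_seq_def
  proof (intro conjI allI impI; (elim conjE)?)
    show "is_set f" using f unfolding attempt_def by blast
    show "\<exists>\<beta> m. \<beta> \<^bold>\<in> osucc \<alpha> \<and> \<beta> \<noteq> nul \<and> p = kpair \<beta> m" if "p \<^bold>\<in> f" for p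
      using that f magma_step_nul unfolding attempt_def by metis
    show "\<exists>!m. kpair \<beta> m \<^bold>\<in> f" if "\<beta> \<^bold>\<in> osucc \<alpha>" "\<beta> \<noteq> nul" for \<beta>
      using that by (rule ex1)
    show "app f (osucc nul) = magma_base R" if "osucc nul \<^bold>\<in> osucc \<alpha>"
      using step[OF that] by (simp add: magma_step_one)
    show "app f (osucc \<beta>) = magma_next (app f \<beta>)" if "\<beta> \<noteq> nul" "osucc \<beta> \<^bold>\<in> osucc \<alpha>" for \<beta>
      using step[OF that(2)] magma_step_osucc_graph[OF graph[OF that(2)] that(1)] by simp
    show "app f \<gamma> = the_set (\<lambda>x. \<exists>\<beta>. \<beta> \<^bold>\<in> \<gamma> \<and> \<beta> \<noteq> nul \<and> x \<^bold>\<in> app f \<beta>)"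
      if "limit_ordinal \<gamma>" "\<gamma> \<^bold>\<in> osucc \<alpha>" for \<gamma>
      using step[OF that(2)] magma_step_limit_graph[OF graph[OF that(2)] that(1)]
        limit_ordinalD(2)[OF that(1)] by simp
  qed
qed

lemma ordinal_rec_magma_iff_level:
  assumes "ordinal \<alpha>" "\<alpha> \<noteq> nul"
  shows "ordinal_rec (magma_step R) \<alpha> m \<longleftrightarrow> m = magma_level R \<alpha>"
proof -
  obtain f where f: "attempt (magma_step R) (osucc \<alpha>) f"
    using magma.ex_attempt ordinal_osucc[OF assms(1)] by blast
  have "(THE f. magma_seq R \<alpha> f) = f"
    using attempt_imp_magma_seq[OF assms(1) f] magma_seq_imp_attempt[OF assms(1)]
      magma.attempt_unique[OF f] by (intro the_equality) blast+
  then have level: "magma_level R \<alpha> = app f \<alpha>" unfolding magma_level_def by simp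
  have rec: "kpair \<alpha> m \<^bold>\<in> f \<longleftrightarrow> ordinal_rec (magma_step R) \<alpha> m" for m
    using magma.kpair_mem_attempt_iff_rec[OF f] by simp
  then have "\<exists>!m. kpair \<alpha> m \<^bold>\<in> f" using ordinal_rec_magma_ex1[OF assms] by simp
  then show ?thesis unfolding level rec[symmetric] by (rule kpair_mem_iff_app)
qed

lemma magma_level_step:
  assumes "ordinal \<alpha>" "\<alpha> \<noteq> nul"
  obtains f where "graph_below f (magma_level R) \<alpha>" "magma_step R f \<alpha> (magma_level R \<alpha>)"
proof -
  obtain f where f: "attempt (magma_step R) \<alpha> f" using magma.ex_attempt assms(1) by blast
  have "graph_below f (magma_level R) \<alpha>"
    unfolding graph_below_def magma.kpair_mem_attempt_iff_rec[OF f]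
    using ordinal_rec_magma_neq_nul ordinal_rec_magma_iff_level ordinal_mem[OF assms(1)] by blast
  moreover have "magma_step R f \<alpha> (magma_level R \<alpha>)"
    using ordinal_rec_magma_iff_level[OF assms] magma.ordinal_rec_iff_step[OF f] by blast
  ultimately show thesis by (rule that)
qed

lemma magma_level_one: "magma_level R (osucc nul) = magma_base R"
  by (rule magma_level_step[of "osucc nul" R]) (simp_all add: magma_step_one)

lemma magma_level_osucc:
  assumes "ordinal \<alpha>" "\<alpha> \<noteq> nul"
  shows "magma_level R (osucc \<alpha>) = magma_next (magma_level R \<alpha>)"
  using assms by (auto intro: magma_level_step[of "osucc \<alpha>" R] simp: magma_step_osucc_graph)

lemma magma_level_limit:
  assumes "limit_ordinal \<gamma>"
  shows "magma_level R \<gamma> = the_set (\<lambda>x. \<exists>\<delta>. \<delta> \<^bold>\<in> \<gamma> \<and> \<delta> \<noteq> nul \<and> x \<^bold>\<in> magma_level R \<delta>)"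
  using limit_ordinalD(1,2)[OF assms]
  by (rule magma_level_step[of \<gamma> R]) (simp add: magma_step_limit_graph[OF _ assms])

definition in_level :: "'v::zfa \<Rightarrow> 'v \<Rightarrow> 'v \<Rightarrow> bool" where
  "in_level R \<alpha> x \<longleftrightarrow> ordinal \<alpha> \<and> \<alpha> \<noteq> nul \<and> x \<^bold>\<in> magma_level R \<alpha>"

lemma in_level_ordinal: "in_level R \<alpha> x \<Longrightarrow> ordinal \<alpha>"
  unfolding in_level_def by blast

lemma magmas_iff: "x \<in> magmas R \<longleftrightarrow> (\<exists>\<alpha>. in_level R \<alpha> x)"
  unfolding magmas_def in_level_def by simp

lemma in_level_iff_rec: "in_level R \<alpha> x \<longleftrightarrow> (\<exists>m. ordinal_rec (magma_step R) \<alpha> m \<and> x \<^bold>\<in> m)"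
proof (cases "ordinal \<alpha> \<and> \<alpha> \<noteq> nul")
  case True
  then show ?thesis by (simp add: in_level_def ordinal_rec_magma_iff_level)
next
  case False
  then show ?thesis
    unfolding in_level_def using ordinal_rec_ordinal ordinal_rec_magma_neq_nul by blast
qed

lemma definable_in_level [definable_intros]:
  "definable_term F \<Longrightarrow> definable_term G \<Longrightarrow> definable (\<lambda>e. in_level R (F e) (G e))"
  by (rule definable_comp2[of "in_level R"]) (unfold in_level_iff_rec, intro definable_intros)

lemma definable_magmas [definable_intros]:
  "definable_term F \<Longrightarrow> definable (\<lambda>e. F e \<in> magmas R)"
  by (rule definable_comp1[of "\<lambda>x. x \<in> magmas R"]) (unfold magmas_iff, intro definable_intros)

lemma small_magma_base:
  "small (\<lambda>x. x \<^bold>\<subseteq> atoms \<and> x \<noteq> nul \<and>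
     (\<forall>a b. a \<^bold>\<in> x \<longrightarrow> b \<^bold>\<in> atoms \<longrightarrow> atom_le R b a \<longrightarrow> b \<^bold>\<in> x))"
  by (rule small_subsets) (intro definable_intros)

lemma small_magma_next:
  "small (\<lambda>x. x \<^bold>\<subseteq> m \<and> x \<noteq> nul \<and> (\<forall>y z. y \<^bold>\<in> x \<longrightarrow> z \<^bold>\<in> m \<longrightarrow> z \<^bold>\<subseteq> y \<longrightarrow> z \<^bold>\<in> x))"
  by (rule small_subsets) (intro definable_intros)

lemma small_magma_limit:
  assumes "limit_ordinal \<gamma>"
  shows "small (\<lambda>x. \<exists>\<delta>. \<delta> \<^bold>\<in> \<gamma> \<and> \<delta> \<noteq> nul \<and> x \<^bold>\<in> magma_level R \<delta>)"
proof -
  have "small (\<lambda>m. \<exists>\<delta>. \<delta> \<^bold>\<in> \<gamma> \<and> ordinal_rec (magma_step R) \<delta> m)"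
  proof (rule small_replacement)
    show "definable (\<lambda>e. ordinal_rec (magma_step R) (e 0) (e 1))" by (intro definable_intros)
  qed (rule magma.ordinal_rec_functional)
  then obtain w where w: "\<And>m. m \<^bold>\<in> w \<longleftrightarrow> (\<exists>\<delta>. \<delta> \<^bold>\<in> \<gamma> \<and> ordinal_rec (magma_step R) \<delta> m)"
    unfolding small_def by blast
  have "(\<exists>m. ordinal_rec (magma_step R) \<delta> m \<and> x \<^bold>\<in> m) \<longleftrightarrow> \<delta> \<noteq> nul \<and> x \<^bold>\<in> magma_level R \<delta>"
    if "\<delta> \<^bold>\<in> \<gamma>" for \<delta> x
    unfolding in_level_iff_rec[symmetric] in_level_def
    using ordinal_mem[OF limit_ordinalD(1)[OF assms] that] by blast
  then have "(\<exists>m. m \<^bold>\<in> w \<and> x \<^bold>\<in> m) \<longleftrightarrow> (\<exists>\<delta>. \<delta> \<^bold>\<in> \<gamma> \<and> \<delta> \<noteq> nul \<and> x \<^bold>\<in> magma_level R \<delta>)" for x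
    unfolding w by blast
  then show ?thesis using small_Union[of w] by simp
qed

lemma is_set_magma_level:
  assumes "ordinal \<alpha>" "\<alpha> \<noteq> nul"
  shows "is_set (magma_level R \<alpha>)"
  using assms(1)
proof (cases rule: ordinal_cases)
  case (osucc \<beta>)
  show ?thesis
  proof (cases "\<beta> = nul")
    case True
    show ?thesis
      unfolding osucc(1) True magma_level_one magma_base_def
      by (rule is_set_the_set[OF small_magma_base])
  next
    case False
    show ?thesis
      unfolding osucc(1) magma_level_osucc[OF osucc(2) False] magma_next_def
      by (rule is_set_the_set[OF small_magma_next])
  qed
next
  case limit
  then show ?thesis by (simp add: magma_level_limit is_set_the_set small_magma_limit)
qed (use assms(2) in blast)

lemma in_level_one_iff:
  "in_level R (osucc nul) x \<longleftrightarrow> x \<^bold>\<subseteq> atoms \<and> x \<noteq> nul \<and>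
     (\<forall>a b. a \<^bold>\<in> x \<longrightarrow> b \<^bold>\<in> atoms \<longrightarrow> atom_le R b a \<longrightarrow> b \<^bold>\<in> x)"
  unfolding in_level_def magma_level_one magma_base_def mem_the_set[OF small_magma_base] by simp

lemma in_level_osucc_iff:
  assumes "ordinal \<alpha>" "\<alpha> \<noteq> nul"
  shows "in_level R (osucc \<alpha>) x \<longleftrightarrow> is_set x \<and> x \<noteq> nul \<and> (\<forall>y. y \<^bold>\<in> x \<longrightarrow> in_level R \<alpha> y) \<and>
     (\<forall>y z. y \<^bold>\<in> x \<longrightarrow> in_level R \<alpha> z \<longrightarrow> z \<^bold>\<subseteq> y \<longrightarrow> z \<^bold>\<in> x)"
  unfolding in_level_def magma_level_osucc[OF assms] magma_next_def mem_the_set[OF small_magma_next]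
    subset_of_def[of x] using assms is_set_magma_level[OF assms] by (simp add: conj_ac)

lemma in_level_limit_iff:
  assumes "limit_ordinal \<gamma>"
  shows "in_level R \<gamma> x \<longleftrightarrow> (\<exists>\<delta>. \<delta> \<^bold>\<in> \<gamma> \<and> in_level R \<delta> x)"
  unfolding in_level_def magma_level_limit[OF assms] mem_the_set[OF small_magma_limit[OF assms]]
  using limit_ordinalD(1,2)[OF assms] ordinal_mem by blast

lemma magma_least_level:
  assumes "x \<in> magmas R"
  obtains \<alpha> where "in_level R \<alpha> x" "\<And>\<beta>. \<beta> \<^bold>\<in> \<alpha> \<Longrightarrow> \<not> in_level R \<beta> x"
proof -
  obtain \<beta> where \<beta>: "in_level R \<beta> x" using assms unfolding magmas_iff by blast
  have "definable (\<lambda>e. in_level R (e 0) x)" by (intro definable_intros)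
  with in_level_ordinal[OF \<beta>] \<beta> show thesis by (rule ordinal_least) (rule that)
qed

lemma magma_is_set:
  assumes "x \<in> magmas R"
  shows "is_set x"
proof -
  obtain \<alpha> where \<alpha>: "in_level R \<alpha> x" "\<And>\<beta>. \<beta> \<^bold>\<in> \<alpha> \<Longrightarrow> \<not> in_level R \<beta> x"
    using magma_least_level[OF assms] by blast
  from in_level_ordinal[OF \<alpha>(1)] show ?thesis
  proof (cases rule: ordinal_cases)
    case nul
    then show ?thesis using \<alpha>(1) unfolding in_level_def by blast
  next
    case (osucc \<beta>)
    then show ?thesis
      using \<alpha>(1) in_level_one_iff[of R x] in_level_osucc_iff[of \<beta> R x] unfolding subset_of_def
      by (cases "\<beta> = nul") blast+
  next
    case limit
    then show ?thesis using \<alpha> in_level_limit_iff by blast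
  qed
qed

lemma magmas_in_common_limit_level:
  assumes "\<And>y. y \<^bold>\<in> x \<Longrightarrow> y \<in> magmas R"
  obtains \<gamma> where "limit_ordinal \<gamma>" "\<And>y. y \<^bold>\<in> x \<Longrightarrow> in_level R \<gamma> y"
proof -
  let ?least = "\<lambda>y \<alpha>. in_level R \<alpha> y \<and> (\<forall>\<beta>. \<beta> \<^bold>\<in> \<alpha> \<longrightarrow> \<not> in_level R \<beta> y)"
  have "small (\<lambda>\<alpha>. \<exists>y. y \<^bold>\<in> x \<and> ?least y \<alpha>)"
  proof (rule small_replacement)
    show "definable (\<lambda>e. ?least (e 0) (e 1))" by (intro definable_intros)
  qed (use ordinal_linear in_level_ordinal in blast)
  then obtain v where v: "\<And>\<alpha>. \<alpha> \<^bold>\<in> v \<longleftrightarrow> (\<exists>y. y \<^bold>\<in> x \<and> ?least y \<alpha>)" unfolding small_def by blast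
  have "ordinal \<alpha>" if "\<alpha> \<^bold>\<in> v" for \<alpha> using that in_level_ordinal unfolding v by blast
  then obtain \<gamma> where \<gamma>: "limit_ordinal \<gamma>" "\<And>\<alpha>. \<alpha> \<^bold>\<in> v \<Longrightarrow> \<alpha> \<^bold>\<in> \<gamma>"
    using limit_ordinal_above_set[of v] by blast
  have "in_level R \<gamma> y" if y: "y \<^bold>\<in> x" for y
  proof -
    obtain \<alpha> where \<alpha>: "in_level R \<alpha> y" "\<And>\<beta>. \<beta> \<^bold>\<in> \<alpha> \<Longrightarrow> \<not> in_level R \<beta> y"
      using magma_least_level[OF assms[OF y]] by blast
    then have "\<alpha> \<^bold>\<in> \<gamma>" using \<gamma>(2) y unfolding v by blast
    then show ?thesis unfolding in_level_limit_iff[OF \<gamma>(1)] using \<alpha>(1) by blast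
  qed
  then show thesis using that \<gamma>(1) by blast
qed

lemma downward_closed_set_of_magmas_is_magma:
  assumes "is_set x" "x \<noteq> nul" and magmas: "\<And>y. y \<^bold>\<in> x \<Longrightarrow> y \<in> magmas R"
    and closed: "\<And>y z. y \<^bold>\<in> x \<Longrightarrow> z \<in> magmas R \<Longrightarrow> z \<^bold>\<subseteq> y \<Longrightarrow> z \<^bold>\<in> x"
  shows "x \<in> magmas R"
proof -
  obtain \<gamma> where \<gamma>: "limit_ordinal \<gamma>" "\<And>y. y \<^bold>\<in> x \<Longrightarrow> in_level R \<gamma> y"
    using magmas_in_common_limit_level[of x R] magmas by blast
  have "in_level R (osucc \<gamma>) x"
    unfolding in_level_osucc_iff[OF limit_ordinalD(1,2)[OF \<gamma>(1)]]
    using assms \<gamma>(2) magmas_iff by blast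
  then show ?thesis unfolding magmas_iff by blast
qed

section \<open>Predecessor sets and the magmatic pair\<close>

lemma
  assumes "is_set x"
  shows is_set_pr: "is_set (pr R x)"
    and mem_pr_iff: "z \<^bold>\<in> pr R x \<longleftrightarrow> z \<in> magmas R \<and> z \<^bold>\<subseteq> x"
proof -
  have "small (\<lambda>z. z \<^bold>\<subseteq> x \<and> z \<in> magmas R)" by (intro small_subsets definable_intros)
  then have small: "small (\<lambda>z. z \<in> magmas R \<and> z \<^bold>\<subseteq> x)" by (simp only: conj_commute)
  have pr: "pr R x = the_set (\<lambda>z. z \<in> magmas R \<and> z \<^bold>\<subseteq> x)"
    using assms unfolding pr_def is_set_def by simp
  show "is_set (pr R x)" unfolding pr by (rule is_set_the_set[OF small])
  show "z \<^bold>\<in> pr R x \<longleftrightarrow> z \<in> magmas R \<and> z \<^bold>\<subseteq> x" unfolding pr by (rule mem_the_set[OF small])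
qed

lemma
  assumes "a \<^bold>\<in> atoms"
  shows is_set_pr_atom: "is_set (pr R a)"
    and mem_pr_atom_iff: "z \<^bold>\<in> pr R a \<longleftrightarrow> z \<^bold>\<in> atoms \<and> atom_le R z a"
proof -
  have small: "small (\<lambda>b. b \<^bold>\<in> atoms \<and> atom_le R b a)" by (intro small_separation definable_intros)
  have pr: "pr R a = the_set (\<lambda>b. b \<^bold>\<in> atoms \<and> atom_le R b a)"
    using assms unfolding pr_def by simp
  show "is_set (pr R a)" unfolding pr by (rule is_set_the_set[OF small])
  show "z \<^bold>\<in> pr R a \<longleftrightarrow> z \<^bold>\<in> atoms \<and> atom_le R z a" unfolding pr by (rule mem_the_set[OF small])
qed

lemma magma_mem_pr: "x \<in> magmas R \<Longrightarrow> x \<^bold>\<in> pr R x"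
  by (simp add: mem_pr_iff magma_is_set subset_refl)

lemma pr_un_pr_magma:
  assumes "x \<in> magmas R" "is_set y"
  shows "pr R x \<^bold>\<union> pr R y \<in> magmas R"
proof (rule downward_closed_set_of_magmas_is_magma)
  have mem: "z \<^bold>\<in> pr R x \<^bold>\<union> pr R y \<longleftrightarrow> z \<in> magmas R \<and> (z \<^bold>\<subseteq> x \<or> z \<^bold>\<subseteq> y)" for z
    using mem_pr_iff[OF magma_is_set[OF assms(1)]] mem_pr_iff[OF assms(2)] by auto
  show "is_set (pr R x \<^bold>\<union> pr R y)" by simp
  show "pr R x \<^bold>\<union> pr R y \<noteq> nul" using magma_mem_pr[OF assms(1)] mem_un not_mem_nul by metis
  show "z \<in> magmas R" if "z \<^bold>\<in> pr R x \<^bold>\<union> pr R y" for z using that unfolding mem by blast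
  show "w \<^bold>\<in> pr R x \<^bold>\<union> pr R y" if "z \<^bold>\<in> pr R x \<^bold>\<union> pr R y" "w \<in> magmas R" "w \<^bold>\<subseteq> z" for w z
    using that subset_trans unfolding mem by blast
qed

lemma pr_magma:
  assumes "x \<in> magmas R"
  shows "pr R x \<in> magmas R"
proof -
  have "is_set x" using assms by (rule magma_is_set)
  then have "pr R x \<^bold>\<union> pr R x = pr R x" using is_set_pr by (intro set_ext) simp_all
  then show ?thesis using pr_un_pr_magma[OF assms \<open>is_set x\<close>] by simp
qed

lemma
  assumes "preorder_on_atoms R" "a \<^bold>\<in> atoms"
  shows atom_mem_pr: "a \<^bold>\<in> pr R a" and pr_atom_magma: "pr R a \<in> magmas R"
proof -
  show a: "a \<^bold>\<in> pr R a"
    using assms unfolding mem_pr_atom_iff[OF assms(2)] preorder_on_atoms_def by blast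
  have trans: "atom_le R b c" if "atom_le R b d" "atom_le R d c" for b c d
    using assms(1) that unfolding preorder_on_atoms_def by blast
  have "is_set (atoms :: 'a)" using assms(2) by (rule is_setI)
  then have "in_level R (osucc nul) (pr R a)"
    unfolding in_level_one_iff subset_of_def mem_pr_atom_iff[OF assms(2)]
    using is_set_pr_atom[OF assms(2)] a trans not_mem_nul by metis
  then show "pr R a \<in> magmas R" unfolding magmas_iff by blast
qed

definition tagged :: "'v::zfa \<Rightarrow> 'v \<Rightarrow> 'v \<Rightarrow> 'v" where
  "tagged R a x = pr R (pr R x) \<^bold>\<union> pr R (pr R a)"

lemma mem_tagged_iff:
  assumes "is_set x" "a \<^bold>\<in> atoms"
  shows "z \<^bold>\<in> tagged R a x \<longleftrightarrow> z \<in> magmas R \<and> (z \<^bold>\<subseteq> pr R x \<or> z \<^bold>\<subseteq> pr R a)"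
  unfolding tagged_def using assms by (auto simp: mem_pr_iff is_set_pr is_set_pr_atom)

lemma tagged_magma:
  assumes "x \<in> magmas R" "a \<^bold>\<in> atoms"
  shows "tagged R a x \<in> magmas R"
  unfolding tagged_def using assms by (intro pr_un_pr_magma pr_magma is_set_pr_atom)

lemma tagged_subsetD:
  assumes R: "preorder_on_atoms R" and atom: "a \<^bold>\<in> atoms" "b \<^bold>\<in> atoms"
    and magma: "x \<in> magmas R" "y \<in> magmas R" and sub: "tagged R a x \<^bold>\<subseteq> tagged R b y"
  shows "atom_le R a b" "x \<^bold>\<subseteq> y"
proof -
  have set: "is_set x" "is_set y" using magma by (auto intro: magma_is_set)
  have pr_subset: "u \<^bold>\<subseteq> pr R y \<or> u \<^bold>\<subseteq> pr R b"
    if "u \<in> magmas R" "u \<^bold>\<subseteq> pr R x \<or> u \<^bold>\<subseteq> pr R a" for u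
  proof -
    have "u \<^bold>\<in> tagged R a x" using that mem_tagged_iff[OF set(1) atom(1)] by blast
    then have "u \<^bold>\<in> tagged R b y" using sub subsetD by blast
    then show ?thesis using mem_tagged_iff[OF set(2) atom(2)] by blast
  qed
  have "pr R a \<^bold>\<subseteq> pr R y \<or> pr R a \<^bold>\<subseteq> pr R b"
    using pr_subset pr_atom_magma[OF R atom(1)] subset_refl[OF is_set_pr_atom[OF atom(1)]] by blast
  then have "a \<^bold>\<in> pr R y \<or> a \<^bold>\<in> pr R b" using atom_mem_pr[OF R atom(1)] subsetD by blast
  then show "atom_le R a b"
    using magma_is_set[of a R] atom(1)
    unfolding mem_pr_iff[OF set(2)] mem_pr_atom_iff[OF atom(2)] is_set_def by blast
  have "pr R x \<^bold>\<subseteq> pr R y \<or> pr R x \<^bold>\<subseteq> pr R b"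
    using pr_subset pr_magma[OF magma(1)] subset_refl[OF is_set_pr[OF set(1)]] by blast
  then have "x \<^bold>\<in> pr R y \<or> x \<^bold>\<in> pr R b" using magma_mem_pr[OF magma(1)] subsetD by blast
  then show "x \<^bold>\<subseteq> y"
    using set(1) unfolding mem_pr_iff[OF set(2)] mem_pr_atom_iff[OF atom(2)] is_set_def by blast
qed

lemma mem_magma_pair_iff:
  "z \<^bold>\<in> magma_pair R a b x y \<longleftrightarrow> z \<in> magmas R \<and> (z \<^bold>\<subseteq> tagged R a x \<or> z \<^bold>\<subseteq> tagged R b y)"
  unfolding magma_pair_def tagged_def by (auto simp: mem_pr_iff)

lemma magma_pair_subsetD:
  assumes R: "preorder_on_atoms R" and atom: "a \<^bold>\<in> atoms" "b \<^bold>\<in> atoms"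
    and incomparable: "\<not> atom_le R a b" "\<not> atom_le R b a"
    and magma: "x \<in> magmas R" "y \<in> magmas R" "x' \<in> magmas R" "y' \<in> magmas R"
    and sub: "magma_pair R a b x y \<^bold>\<subseteq> magma_pair R a b x' y'"
  shows "x \<^bold>\<subseteq> x'" "y \<^bold>\<subseteq> y'"
proof -
  have "tagged R a x \<^bold>\<in> magma_pair R a b x y" "tagged R b y \<^bold>\<in> magma_pair R a b x y"
    using tagged_magma magma_is_set subset_refl magma atom unfolding mem_magma_pair_iff by blast+
  then have "tagged R a x \<^bold>\<in> magma_pair R a b x' y'" "tagged R b y \<^bold>\<in> magma_pair R a b x' y'"
    using sub subsetD by blast+
  then have "tagged R a x \<^bold>\<subseteq> tagged R a x' \<or> tagged R a x \<^bold>\<subseteq> tagged R b y'"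
    "tagged R b y \<^bold>\<subseteq> tagged R a x' \<or> tagged R b y \<^bold>\<subseteq> tagged R b y'"
    unfolding mem_magma_pair_iff by blast+
  then show "x \<^bold>\<subseteq> x'" "y \<^bold>\<subseteq> y'" using tagged_subsetD[OF R] atom magma incomparable by blast+
qed

theorem theorem3p4:
  fixes R a0 a1 x y x' y' :: "'v::zfa"
  assumes "preorder_on_atoms R"
    and "no_minimal_atoms R"
    and "a0 \<^bold>\<in> atoms" and "a1 \<^bold>\<in> atoms"
    and "\<not> atom_le R a0 a1" and "\<not> atom_le R a1 a0"
    and "x \<in> magmas R" and "y \<in> magmas R" and "x' \<in> magmas R" and "y' \<in> magmas R"
  shows "magma_pair R a0 a1 x y = magma_pair R a0 a1 x' y' \<longleftrightarrow> x = x' \<and> y = y'"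
proof
  assume eq: "magma_pair R a0 a1 x y = magma_pair R a0 a1 x' y'"
  have "is_set (magma_pair R a0 a1 x y)" unfolding magma_pair_def by simp
  then have sub: "magma_pair R a0 a1 x y \<^bold>\<subseteq> magma_pair R a0 a1 x' y'"
    "magma_pair R a0 a1 x' y' \<^bold>\<subseteq> magma_pair R a0 a1 x y"
    unfolding eq by (auto intro: subset_refl)
  have "x \<^bold>\<subseteq> x'" "y \<^bold>\<subseteq> y'"
    using magma_pair_subsetD[OF assms(1,3-6,7,8,9,10) sub(1)] .
  moreover have "x' \<^bold>\<subseteq> x" "y' \<^bold>\<subseteq> y"
    using magma_pair_subsetD[OF assms(1,3-6,9,10,7,8) sub(2)] .
  ultimately show "x = x' \<and> y = y'" using subset_antisym by blast
qed simp

end
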